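(* Let $(X,\|\cdot\|)$ be a Banach space with a normalized, shrinking, bimonotone basis $(e_i)$. Suppose that there exist infinite subsets $N$, $P$ of $\mathbb{N}$, a scalar sequence $\mathbf{a}=(\delta_i)$ and $d>1$ such that $X$ satisfies the $(d,N,P,\mathbf{a})$ distortion property. Then $X$ is arbitrarily distortable.
   Context: All Banach spaces are real and infinite dimensional; a subspace means an infinite dimensional closed linear subspace. $(X,\|\cdot\|)$ is arbitrarily distortable if for every $\lambda>1$ there is an equivalent norm $|\cdot|$ on $X$ such that every subspace $Y$ of $X$ contains non-zero vectors $x,y$ with $\|x\|=\|y\|$ and $|x|/|y|>\lambda$. Schreier families: $S_0=\{\{n\}:n\in\mathbb{N}\}\cup\{\emptyset\}$ and, for $\xi<\omega$, $S_{\xi+1}=\{\bigcup_{i=1}^n F_i: n\in\mathbb{N},\ n\le\min F_1,\ F_1<\cdots<F_n,\ F_i\in S_\xi\ (i\le n)\}\cup\{\emptyset\}$, where $E<F$ means $\max E<\min F$. For a basis $(e_n)$ of $X$, a block basis of $(e_n)$ is a sequence of (non-zero) vectors $u_n=\sum_{i\in F_n}a_ie_i$ with $F_1<F_2<\cdots$ finite subsets of $\mathbb{N}$; a block subspace is the closed linear span of a block basis. A normalized sequence $(x_n)$ is an $\epsilon$-$\ell_1^\xi$ spreading model ($\epsilon>0$) if $\|\sum_{i\in F}a_ix_i\|\ge\epsilon\sum_{i\in F}|a_i|$ for every $F\in S_\xi$ and all scalars $(a_i)_{i\in F}$. A space $X$ with basis $(e_n)$ is asymptotic $\epsilon$-$\ell_1^\xi$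 if every normalized block basis of $(e_n)$ is an $\epsilon$-$\ell_1^\xi$ spreading model. For $\delta>0$, $\tau(X,\delta)$ is the supremum of all $\zeta<\omega$ such that every normalized block basis of $(e_n)$ has a subsequence which is a $\delta$-$\ell_1^\zeta$ spreading model. For a block subspace $U$ of $X$, $\tau(U,\delta)$ is computed with respect to the block basis generating $U$. Distortion property: let $N=(n_i)$, $P=(p_i)$ be infinite subsets of $\mathbb{N}$ (enumerated increasingly) with $p_i<n_i/2$ for every $i\ge1$ and $n_{i-1}\le p_i$ for every $i\ge2$; let $\mathbf{a}=(\delta_i)$ be a decreasing null sequence of (positive) scalars and $d>1$. A space $X$ with basis $(e_i)$ satisfies the $(d,N,P,\mathbf{a})$ distortion property if for every $j\in\mathbb{N}$, $X$ is an asymptotic $\delta_j$-$\ell_1^{n_j}$ space and $\tau(U,d\delta_j)<p_j$ for every block subspace $U$ of $X$. *)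

theory Defs
  imports "HOL-Analysis.Analysis"
begin

text \<open>Sequences of vectors are indexed from 0, so the vector called x_(i+1) on paper is written
  x i. Schreier sets keep their usual meaning as sets of positive integers; the shift is made
  once, in the definition of spreading models below.\<close>

definition schauder_basis :: "(nat \<Rightarrow> 'a::real_normed_vector) \<Rightarrow> bool" where
  "schauder_basis e \<longleftrightarrow> (\<forall>x. \<exists>!a::nat \<Rightarrow> real. (\<lambda>n. a n *\<^sub>R e n) sums x)"

definition normalized_seq :: "(nat \<Rightarrow> 'a::real_normed_vector) \<Rightarrow> bool" where
  "normalized_seq x \<longleftrightarrow> (\<forall>n. norm (x n) = 1)"

text \<open>A basis is shrinking if its biorthogonal functionals form a basis of the (norm) dual.
  For a Schauder basis of a Banach space the biorthogonal functionals exist and are unique.\<close>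

definition shrinking_basis :: "(nat \<Rightarrow> 'a::real_normed_vector) \<Rightarrow> bool" where
  "shrinking_basis e \<longleftrightarrow> schauder_basis e \<and>
     (\<exists>f :: nat \<Rightarrow> ('a \<Rightarrow>\<^sub>L real).
        (\<forall>m n. blinfun_apply (f m) (e n) = (if m = n then 1 else 0)) \<and> schauder_basis f)"

text \<open>All projections onto intervals of the basis have norm at most one.\<close>

definition bimonotone_basis :: "(nat \<Rightarrow> 'a::real_normed_vector) \<Rightarrow> bool" where
  "bimonotone_basis e \<longleftrightarrow> schauder_basis e \<and>
     (\<forall>(a::nat \<Rightarrow> real) x. (\<lambda>n. a n *\<^sub>R e n) sums x \<longrightarrow>
        (\<forall>m n. norm (\<Sum>i=m..n. a i *\<^sub>R e i) \<le> norm x))"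

text \<open>Only used for finite nonempty sets.\<close>

definition set_less :: "nat set \<Rightarrow> nat set \<Rightarrow> bool" where
  "set_less E F \<longleftrightarrow> Max E < Min F"

text \<open>The pieces of a Schreier set are taken nonempty, so that their minima and maxima make
  sense; empty pieces could be dropped without changing the union.\<close>

fun schreier :: "nat \<Rightarrow> nat set set" where
  "schreier 0 = insert {} {{n} | n. 1 \<le> n}"
| "schreier (Suc \<xi>) = insert {} {(\<Union>i\<in>{1..n}. F i) | n F.
     1 \<le> n \<and> (\<forall>i\<in>{1..n}. F i \<noteq> {} \<and> F i \<in> schreier \<xi>) \<and> n \<le> Min (F 1) \<and>
     (\<forall>i. 1 \<le> i \<and> i < n \<longrightarrow> set_less (F i) (F (Suc i)))}"

definition block_basis :: "(nat \<Rightarrow> 'a::real_normed_vector) \<Rightarrow> (nat \<Rightarrow> 'a) \<Rightarrow> bool" where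
  "block_basis e u \<longleftrightarrow> (\<exists>(F :: nat \<Rightarrow> nat set) (a :: nat \<Rightarrow> real).
     (\<forall>n. finite (F n) \<and> F n \<noteq> {}) \<and> (\<forall>n. set_less (F n) (F (Suc n))) \<and>
     (\<forall>n. u n = (\<Sum>i\<in>F n. a i *\<^sub>R e i) \<and> u n \<noteq> 0))"

definition l1_spreading_model :: "real \<Rightarrow> nat \<Rightarrow> (nat \<Rightarrow> 'a::real_normed_vector) \<Rightarrow> bool" where
  "l1_spreading_model \<epsilon> \<xi> x \<longleftrightarrow> 0 < \<epsilon> \<and> normalized_seq x \<and>
     (\<forall>F (a :: nat \<Rightarrow> real). Suc ` F \<in> schreier \<xi> \<longrightarrow>
        norm (\<Sum>i\<in>F. a i *\<^sub>R x i) \<ge> \<epsilon> * (\<Sum>i\<in>F. \<bar>a i\<bar>))"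

definition asymptotic_l1 :: "real \<Rightarrow> nat \<Rightarrow> (nat \<Rightarrow> 'a::real_normed_vector) \<Rightarrow> bool" where
  "asymptotic_l1 \<epsilon> \<xi> e \<longleftrightarrow>
     (\<forall>u. block_basis e u \<and> normalized_seq u \<longrightarrow> l1_spreading_model \<epsilon> \<xi> u)"

text \<open>The supremum is taken in the extended naturals; it is infinite if there are arbitrarily
  large admissible orders, and 0 if there are none. The first argument is the basis (or, for a
  block subspace, the generating block basis).\<close>

definition l1_index :: "(nat \<Rightarrow> 'a::real_normed_vector) \<Rightarrow> real \<Rightarrow> enat" where
  "l1_index e \<delta> = Sup {enat \<zeta> | \<zeta>. \<forall>u. block_basis e u \<and> normalized_seq u \<longrightarrow>
     (\<exists>r :: nat \<Rightarrow> nat. strict_mono r \<and> l1_spreading_model \<delta> \<zeta> (u \<circ> r))}"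

text \<open>A block subspace enters only through its generating block basis u.\<close>

definition distortion_property ::
  "(nat \<Rightarrow> 'a::real_normed_vector) \<Rightarrow> real \<Rightarrow> nat set \<Rightarrow> nat set \<Rightarrow> (nat \<Rightarrow> real) \<Rightarrow> bool" where
  "distortion_property e d N P \<delta> \<longleftrightarrow>
     infinite N \<and> 0 \<notin> N \<and> infinite P \<and> 0 \<notin> P \<and>
     (\<forall>i. real (enumerate P i) < real (enumerate N i) / 2) \<and>
     (\<forall>i. enumerate N i \<le> enumerate P (Suc i)) \<and>
     decseq \<delta> \<and> \<delta> \<longlonglongrightarrow> 0 \<and> (\<forall>i. 0 < \<delta> i) \<and> 1 < d \<and>
     (\<forall>j. asymptotic_l1 (\<delta> j) (enumerate N j) e \<and>
          (\<forall>u. block_basis e u \<longrightarrow> l1_index u (d * \<delta> j) < enat (enumerate P j)))"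

definition equivalent_norm :: "('a::real_normed_vector \<Rightarrow> real) \<Rightarrow> bool" where
  "equivalent_norm p \<longleftrightarrow>
     (\<forall>x. p x = 0 \<longleftrightarrow> x = 0) \<and> (\<forall>x y. p (x + y) \<le> p x + p y) \<and>
     (\<forall>c x. p (c *\<^sub>R x) = \<bar>c\<bar> * p x) \<and>
     (\<exists>c C. 0 < c \<and> 0 < C \<and> (\<forall>x. c * norm x \<le> p x \<and> p x \<le> C * norm x))"

definition infinite_dim_closed_subspace :: "'a::real_normed_vector set \<Rightarrow> bool" where
  "infinite_dim_closed_subspace Y \<longleftrightarrow>
     subspace Y \<and> closed Y \<and> \<not> (\<exists>B. finite B \<and> Y \<subseteq> span B)"

definition arbitrarily_distortable :: "'a::real_normed_vector itself \<Rightarrow> bool" where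
  "arbitrarily_distortable _ \<longleftrightarrow>
     (\<forall>l>1. \<exists>p :: 'a \<Rightarrow> real. equivalent_norm p \<and>
        (\<forall>Y. infinite_dim_closed_subspace Y \<longrightarrow>
           (\<exists>x\<in>Y. \<exists>y\<in>Y. x \<noteq> 0 \<and> y \<noteq> 0 \<and> norm x = norm y \<and> p x / p y > l)))"

end

theory Submission
  imports Defs
begin

text \<open>Fix \<open>j\<close> and write \<open>p\<close>, \<open>n\<close>, \<open>\<delta>\<close> for \<open>p_j\<close>, \<open>n_j\<close>, \<open>\<delta>_j\<close>. The distorting norm is
  \<open>norm x\<close> plus the supremum of \<open>\<Sum>norm (E x)\<close> over successive intervals \<open>E\<close> of the basis indexed by a
  set in \<open>S_p\<close>; iterating the \<open>S_1\<close> estimate \<open>p\<close> times shows that it is equivalent. Every block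
  subspace contains a combination of normalized blocks over a set in \<open>S_p\<close> of norm less than \<open>d * \<delta>\<close>
  times its coefficient sum; its new norm is at least \<open>1 / (d * \<delta>)\<close> times the old one. If all
  normalized blocks had new norm greater than about \<open>d\<close>, then splitting each term of such a combination
  would give a combination over a set of order \<open>2 * p \<le> n\<close> whose coefficient sum is more than \<open>d\<close> times
  larger, contradicting the lower estimate with constant \<open>\<delta>\<close>. For the splitting to be
  compatible with positions in a block basis, one first passes to blocks of widely spaced vectors that
  are \<open>S_{p+1}\<close>-averages, so that intervals cutting through one of these vectors contribute
  little.\<close>

section \<open>Schreier families\<close>

text \<open>The ratio reached is \<open>1 / (4 * d * \<delta> * (d + 3))\<close>; it is unbounded
  over \<open>j\<close> because \<open>d\<close> stays fixed while \<delta>_j tends to 0. The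
  obstacle is that a spreading model estimate sees only the index of a vector in its sequence. To
  bound \<open>norm x\<close> below by its projections onto given intervals, these must sit in one
  block basis of \<open>e\<close> at indices forming a Schreier set, and \<open>x\<close> must
  vanish on the terms at the indices skipped in between: bimonotonicity controls interval
  projections but cannot delete inner terms. Consecutive indices skip nothing, hence the iterated
  S_1 estimate for arbitrary intervals. Its cost \<open>(1 / \<delta>) ^ p\<close> would ruin the
  contradiction, but is harmless in the equivalence constant and in errors chosen small relative to
  it. The sharp constant \<delta> requires places for the skipped indices, and the wide spacing
  provides them. The bound \<open>p < n / 2\<close> makes room for composing two families of order
  \<open>p\<close>; with \<open>p \<ge> 1\<close> it also gives \<open>p + 1 \<le> n\<close>, so
  that the averages have norm at least \<delta>.\<close>

definition sch :: "nat \<Rightarrow> nat set set" where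
  "sch p = {T. Suc ` T \<in> schreier p}"

lemma sch_0: "T \<in> sch 0 \<longleftrightarrow> T = {} \<or> (\<exists>t. T = {t})"
proof
  assume "T \<in> sch 0"
  then consider "Suc ` T = {}" | n where "Suc ` T = {n}" "1 \<le> n"
    by (auto simp: sch_def)
  then show "T = {} \<or> (\<exists>t. T = {t})"
  proof cases
    case (2 n)
    then obtain t where "t \<in> T" by auto
    with 2 have "T = {t}" by (auto simp: set_eq_iff image_iff) (metis nat.inject)+
    then show ?thesis by blast
  qed simp
qed (auto simp: sch_def)

lemma sch_empty [simp]: "{} \<in> sch p"
  by (cases p) (auto simp: sch_def)

lemma finite_schreier: "A \<in> schreier p \<Longrightarrow> finite A \<and> 0 \<notin> A"
proof (induction p arbitrary: A)
  case (Suc p)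
  show ?case using Suc.prems
    by (auto dest: Suc.IH)
qed auto

lemma finite_sch: "T \<in> sch p \<Longrightarrow> finite T"
  using finite_schreier[of "Suc ` T" p] by (auto simp: sch_def finite_image_iff)

text \<open>The recursion compares only consecutive pieces; chaining the comparisons through the
  nonempty pieces in between orders all of them, and the bound on the first minimum passes to every
  element. It reads \<open>n \<le> Suc t\<close> because indices start from 0.\<close>

lemma sch_SucE:
  assumes "T \<in> sch (Suc p)" "T \<noteq> {}"
  obtains n F where "T = (\<Union>i<n. F i)"
    "\<And>i. i < n \<Longrightarrow> F i \<in> sch p" "\<And>t. t \<in> T \<Longrightarrow> n \<le> Suc t"
    "\<And>i k x y. i < k \<Longrightarrow> k < n \<Longrightarrow> x \<in> F i \<Longrightarrow> y \<in> F k \<Longrightarrow> x < y"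
    "1 \<le> n" "\<And>i. i < n \<Longrightarrow> F i \<noteq> {}"
proof -
  from assms obtain n G where G: "Suc ` T = (\<Union>i\<in>{1..n}. G i)" and n: "1 \<le> n"
    and ne: "\<And>i. i \<in> {1..n} \<Longrightarrow> G i \<noteq> {}" and inS: "\<And>i. i \<in> {1..n} \<Longrightarrow> G i \<in> schreier p"
    and n1: "n \<le> Min (G 1)" and lt: "\<And>i. 1 \<le> i \<Longrightarrow> i < n \<Longrightarrow> set_less (G i) (G (Suc i))"
    unfolding sch_def mem_Collect_eq schreier.simps by blast
  have fin: "finite (G i)" "0 \<notin> G i" if "i \<in> {1..n}" for i
    using finite_schreier[OF inS[OF that]] by auto
  have step: "x < y" if "i < k" "1 \<le> i" "k \<le> n" "x \<in> G i" "y \<in> G k" for i k x y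
    using that
  proof (induction k arbitrary: y)
    case (Suc k)
    have less: "u < w" if "u \<in> G k" "w \<in> G (Suc k)" "1 \<le> k" for u w
    proof -
      have "u \<le> Max (G k)" using fin[of k] Suc.prems that by auto
      also have "\<dots> < Min (G (Suc k))" using lt[of k] Suc.prems that by (auto simp: set_less_def)
      also have "\<dots> \<le> w" using fin[of "Suc k"] Suc.prems that by auto
      finally show ?thesis .
    qed
    show ?case
    proof (cases "i = k")
      case True with less Suc.prems show ?thesis by auto
    next
      case False
      then have ik: "i < k" "k \<le> n" "1 \<le> k" using Suc.prems by auto
      obtain w where w: "w \<in> G k" using ne[of k] ik by auto
      show ?thesis using Suc.IH[OF ik(1) Suc.prems(2) ik(2) Suc.prems(4) w] less[OF w Suc.prems(5) ik(3)] by simp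
    qed
  qed simp
  have all: "n \<le> y" if "y \<in> Suc ` T" for y
  proof -
    from that G obtain i where i: "i \<in> {1..n}" "y \<in> G i" by auto
    have m: "Min (G 1) \<in> G 1" using fin[of 1] ne[of 1] n by (auto intro!: Min_in)
    show ?thesis
    proof (cases "i = 1")
      case True
      then have "Min (G 1) \<le> y" using i fin[of 1] n by (intro Min_le) auto
      with n1 show ?thesis by (rule order.trans)
    next
      case False then show ?thesis using step[of 1 i "Min (G 1)" y] i m n1 by auto
    qed
  qed
  define F where "F i = {t. Suc t \<in> G (Suc i)}" for i
  have SF: "Suc ` F i = G (Suc i)" if "i < n" for i
  proof -
    have "x \<in> Suc ` F i" if "x \<in> G (Suc i)" for x
      using fin(2)[of "Suc i"] \<open>i < n\<close> that by (cases x) (auto simp: F_def)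
    then show ?thesis by (auto simp: F_def)
  qed
  have "T = (\<Union>i<n. F i)"
  proof -
    have "{1..n} = Suc ` {..<n}" by (simp add: image_Suc_lessThan)
    then have "Suc ` T = (\<Union>i<n. G (Suc i))" using G by simp
    also have "\<dots> = Suc ` (\<Union>i<n. F i)" using SF by (auto simp: image_UN)
    finally show ?thesis by (simp add: inj_image_eq_iff)
  qed
  then show thesis
  proof (rule that[OF _ _ _ _ n])
    show "F i \<noteq> {}" if "i < n" for i using SF[OF that] ne[of "Suc i"] that by auto
    show "F i \<in> sch p" if "i < n" for i using SF[OF that] inS[of "Suc i"] that by (auto simp: sch_def)
    show "n \<le> Suc t" if "t \<in> T" for t using all that by auto
    show "x < y" if "i < k" "k < n" "x \<in> F i" "y \<in> F k" for i k x y
      using step[of "Suc i" "Suc k" "Suc x" "Suc y"] that by (auto simp: F_def)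
  qed
qed

text \<open>Unlike in the definition of the Schreier families, empty pieces are allowed here.\<close>

lemma sch_SucI:
  assumes inS: "\<And>i. i < n \<Longrightarrow> F i \<in> sch p"
    and ord: "\<And>i k x y. i < k \<Longrightarrow> k < n \<Longrightarrow> x \<in> F i \<Longrightarrow> y \<in> F k \<Longrightarrow> x < y"
    and le: "\<And>i t. i < n \<Longrightarrow> t \<in> F i \<Longrightarrow> n \<le> Suc t"
  shows "(\<Union>i<n. F i) \<in> sch (Suc p)"
proof (cases "(\<Union>i<n. F i) = {}")
  case False
  \<comment> \<open>Deleting the empty pieces only lowers their number, so the size bound
    survives.\<close>
  define Fs where "Fs = filter (\<lambda>A. A \<noteq> {}) (map F [0..<n])"
  have set: "set Fs = {F i | i. i < n \<and> F i \<noteq> {}}" by (auto simp: Fs_def)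
  have srt: "sorted_wrt (\<lambda>A B. \<forall>x\<in>A. \<forall>y\<in>B. x < y) Fs"
    unfolding Fs_def
    by (intro sorted_wrt_filter, unfold sorted_wrt_map)
       (rule sorted_wrt_mono_rel[OF _ sorted_wrt_upt], simp, blast intro: ord)
  define m where "m = length Fs"
  have mn: "m \<le> n" unfolding m_def Fs_def by (rule order.trans[OF length_filter_le]) simp
  have m1: "1 \<le> m" using False set unfolding m_def by (cases Fs) auto
  define G where "G i = Suc ` (Fs ! (i - 1))" for i
  have mem: "\<exists>k<n. Fs ! (i - 1) = F k \<and> F k \<noteq> {}" if "i \<in> {1..m}" for i
  proof -
    have "Fs ! (i - 1) \<in> set Fs" using that by (auto simp: m_def)
    then show ?thesis using set by auto
  qed
  have "Suc ` (\<Union>i<n. F i) = Suc ` (\<Union>(set Fs))" unfolding set by auto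
  also have "\<Union>(set Fs) = (\<Union>i\<in>{1..m}. Fs ! (i - 1))"
  proof -
    have "set Fs = (\<lambda>i. Fs ! i) ` {..<m}"
      by (auto simp: set_conv_nth m_def)
    also have "\<dots> = (\<lambda>i. Fs ! (i - 1)) ` Suc ` {..<m}" by (simp add: image_image)
    also have "Suc ` {..<m} = {1..m}" by (simp add: image_Suc_lessThan)
    finally show ?thesis by simp
  qed
  also have "Suc ` \<dots> = (\<Union>i\<in>{1..m}. G i)" by (auto simp: G_def)
  finally have eq: "Suc ` (\<Union>i<n. F i) = (\<Union>i\<in>{1..m}. G i)" .
  have fin: "finite (G i)" "G i \<noteq> {}" "G i \<in> schreier p" if "i \<in> {1..m}" for i
  proof -
    from mem[OF that] obtain k where "k < n" "Fs ! (i - 1) = F k" "F k \<noteq> {}" by auto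
    with inS[of k] finite_sch[OF inS[of k]] show "finite (G i)" "G i \<noteq> {}" "G i \<in> schreier p"
      by (auto simp: G_def sch_def)
  qed
  have "m \<le> Min (G 1)"
  proof -
    have "Min (G 1) \<in> G 1" using fin[of 1] m1 by (intro Min_in) auto
    with mem[of 1] m1 le mn show ?thesis by (fastforce simp: G_def)
  qed
  moreover have "set_less (G i) (G (Suc i))" if "1 \<le> i" "i < m" for i
  proof -
    have a: "Max (G i) \<in> G i" using fin[of i] that by (intro Max_in) auto
    have b: "Min (G (Suc i)) \<in> G (Suc i)" using fin[of "Suc i"] that by (intro Min_in) auto
    have "\<forall>x\<in>Fs ! (i - 1). \<forall>y\<in>Fs ! i. x < y"
      using srt[unfolded sorted_wrt_iff_nth_less, rule_format, of "i - 1" i] that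
      unfolding m_def by auto
    with a b show ?thesis by (auto simp: set_less_def G_def)
  qed
  ultimately show ?thesis
    unfolding sch_def using eq fin m1 by (auto intro!: exI[of _ m] exI[of _ G])
qed simp

lemma sch_subset: "T \<in> sch p \<Longrightarrow> U \<subseteq> T \<Longrightarrow> U \<in> sch p"
proof (induction p arbitrary: T U)
  case 0
  then show ?case by (auto simp: sch_0)
next
  case (Suc p)
  show ?case
  proof (cases "T = {}")
    case False
    obtain n F where F: "T = (\<Union>i<n. F i)" "\<And>i. i < n \<Longrightarrow> F i \<in> sch p" "\<And>t. t \<in> T \<Longrightarrow> n \<le> Suc t"
      "\<And>i k x y. i < k \<Longrightarrow> k < n \<Longrightarrow> x \<in> F i \<Longrightarrow> y \<in> F k \<Longrightarrow> x < y"
      by (rule sch_SucE[OF Suc.prems(1) False]) (rule that)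
    have "(\<Union>i<n. F i \<inter> U) \<in> sch (Suc p)"
    proof (rule sch_SucI)
      show "F i \<inter> U \<in> sch p" if "i < n" for i using Suc.IH[OF F(2)[OF that]] by simp
      show "x < y" if "i < k" "k < n" "x \<in> F i \<inter> U" "y \<in> F k \<inter> U" for i k x y
        using F(4)[of i k x y] that by blast
      show "n \<le> Suc t" if "i < n" "t \<in> F i \<inter> U" for i t
        using F(1) F(3)[of t] that by blast
    qed
    moreover have "(\<Union>i<n. F i \<inter> U) = U" using F(1) Suc.prems(2) by auto
    ultimately show ?thesis by simp
  qed (use Suc.prems in auto)
qed

text \<open>Moving elements to the right in the same order only relaxes the bound that the minimum
  puts on the number of pieces, at every level of the recursion.\<close>

lemma sch_spread:
  assumes "T \<in> sch p" "\<And>t. t \<in> T \<Longrightarrow> t \<le> g t" "\<And>s t. s \<in> T \<Longrightarrow> t \<in> T \<Longrightarrow> s < t \<Longrightarrow> g s < g t"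
  shows "g ` T \<in> sch p"
  using assms
proof (induction p arbitrary: T)
  case 0
  then show ?case by (auto simp: sch_0)
next
  case (Suc p)
  show ?case
  proof (cases "T = {}")
    case False
    obtain n F where F: "T = (\<Union>i<n. F i)" "\<And>i. i < n \<Longrightarrow> F i \<in> sch p" "\<And>t. t \<in> T \<Longrightarrow> n \<le> Suc t"
      "\<And>i k x y. i < k \<Longrightarrow> k < n \<Longrightarrow> x \<in> F i \<Longrightarrow> y \<in> F k \<Longrightarrow> x < y"
      by (rule sch_SucE[OF Suc.prems(1) False]) (rule that)
    have "(\<Union>i<n. g ` F i) \<in> sch (Suc p)"
    proof (rule sch_SucI)
      fix i assume i: "i < n"
      then show "g ` F i \<in> sch p" using F(1,2) Suc.prems(2,3) by (intro Suc.IH) blast+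
    next
      fix i k x y assume "i < k" "k < n" "x \<in> g ` F i" "y \<in> g ` F k"
      then obtain a b where ab: "a \<in> F i" "b \<in> F k" "x = g a" "y = g b" by auto
      moreover have "a \<in> T" "b \<in> T" using F(1) ab \<open>i < k\<close> \<open>k < n\<close> by auto
      ultimately show "x < y" using F(4)[of i k a b] Suc.prems(3)[of a b] \<open>i < k\<close> \<open>k < n\<close> by simp
    next
      fix i t assume "i < n" "t \<in> g ` F i"
      then obtain a where a: "a \<in> F i" "t = g a" by auto
      then have "a \<in> T" using F(1) \<open>i < n\<close> by auto
      then show "n \<le> Suc t" using F(3)[of a] Suc.prems(2)[of a] a by simp
    qed
    moreover have "(\<Union>i<n. g ` F i) = g ` T" using F(1) by auto
    ultimately show ?thesis by simp
  qed simp
qed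

lemma sch_mono: "p \<le> q \<Longrightarrow> sch p \<subseteq> sch q"
proof (induction q rule: dec_induct)
  case (step q)
  have "T \<in> sch (Suc q)" if "T \<in> sch q" for T
    using sch_SucI[of 1 "\<lambda>_. T" q] that by (auto simp: lessThan_Suc)
  with step show ?case by blast
qed simp

text \<open>After the shift the first element counts as \<open>m + 1\<close>, which is how many
  singletons it permits.\<close>

lemma sch_interval: "k \<le> Suc m \<Longrightarrow> 1 \<le> p \<Longrightarrow> {m..<m + k} \<in> sch p"
proof -
  assume k: "k \<le> Suc m" and p: "1 \<le> p"
  have "(\<Union>i<k. {m + i}) \<in> sch (Suc 0)"
    by (rule sch_SucI) (use k in \<open>auto simp: sch_0\<close>)
  moreover have "(\<Union>i<k. {m + i}) = {m..<m + k}"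
  proof
    show "{m..<m + k} \<subseteq> (\<Union>i<k. {m + i})"
    proof
      fix x assume "x \<in> {m..<m + k}"
      then have "x - m < k" "x = m + (x - m)" by auto
      then show "x \<in> (\<Union>i<k. {m + i})" by blast
    qed
  qed auto
  ultimately show ?thesis using sch_mono[of 1 p] p by auto
qed

text \<open>Composition of Schreier families: recursion on the outer family regroups the sets
  \<open>A l\<close>. Since \<open>l\<close> lies below \<open>A l\<close>, a bound on the number of
  pieces by the elements of \<open>F\<close> is also a bound by the elements of the union.\<close>

lemma sch_Union:
  assumes "F \<in> sch p" "\<And>l. l \<in> F \<Longrightarrow> A l \<in> sch q" "\<And>l x. l \<in> F \<Longrightarrow> x \<in> A l \<Longrightarrow> l \<le> x"
    "\<And>l k x y. l \<in> F \<Longrightarrow> k \<in> F \<Longrightarrow> l < k \<Longrightarrow> x \<in> A l \<Longrightarrow> y \<in> A k \<Longrightarrow> x < y"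
  shows "(\<Union>l\<in>F. A l) \<in> sch (p + q)"
  using assms
proof (induction p arbitrary: F)
  case 0
  then show ?case by (auto simp: sch_0)
next
  case (Suc p)
  show ?case
  proof (cases "F = {}")
    case False
    obtain n G where G: "F = (\<Union>i<n. G i)" "\<And>i. i < n \<Longrightarrow> G i \<in> sch p" "\<And>t. t \<in> F \<Longrightarrow> n \<le> Suc t"
      "\<And>i k x y. i < k \<Longrightarrow> k < n \<Longrightarrow> x \<in> G i \<Longrightarrow> y \<in> G k \<Longrightarrow> x < y"
      by (rule sch_SucE[OF Suc.prems(1) False]) (rule that)
    have sub: "l \<in> F" if "i < n" "l \<in> G i" for i l using G(1) that by auto
    have "(\<Union>i<n. \<Union>l\<in>G i. A l) \<in> sch (Suc (p + q))"
    proof (rule sch_SucI)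
      fix i assume i: "i < n"
      show "(\<Union>l\<in>G i. A l) \<in> sch (p + q)"
        by (rule Suc.IH[OF G(2)[OF i]]) (use Suc.prems(2-4) sub[OF i] in blast)+
    next
      fix i k x y assume ik: "i < k" "k < n" and "x \<in> (\<Union>l\<in>G i. A l)" "y \<in> (\<Union>l\<in>G k. A l)"
      then obtain a b where "a \<in> G i" "x \<in> A a" "b \<in> G k" "y \<in> A b" by auto
      with ik show "x < y" using Suc.prems(4)[of a b x y] sub[of i a] sub[of k b] G(4)[of i k a b] by simp
    next
      fix i t assume i: "i < n" and "t \<in> (\<Union>l\<in>G i. A l)"
      then obtain a where a: "a \<in> G i" "t \<in> A a" by auto
      then have "a \<le> t" "n \<le> Suc a" using Suc.prems(3)[of a t] sub[OF i a(1)] G(3)[of a] by auto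
      then show "n \<le> Suc t" by simp
    qed
    moreover have "(\<Union>i<n. \<Union>l\<in>G i. A l) = (\<Union>l\<in>F. A l)" using G(1) by auto
    ultimately show ?thesis by simp
  qed simp
qed

text \<open>Later \<open>m\<close> numbers a block cut by an endpoint of an interval,
  \<open>\<tau> m\<close> is the index of that interval and \<open>\<beta> m\<close> the right end
  of the block. Heredity handles the values of \<open>\<tau>\<close>, and spreading moves each of
  them to \<open>\<beta> m\<close>.\<close>

lemma sch_image_dominating:
  assumes T: "T \<in> sch p" and \<tau>: "\<tau> ` B \<subseteq> T" "\<And>m. m \<in> B \<Longrightarrow> \<tau> m \<le> \<beta> m"
    and lt: "\<And>m m'. m \<in> B \<Longrightarrow> m' \<in> B \<Longrightarrow> m < m' \<Longrightarrow> \<tau> m < \<tau> m'"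
    and \<beta>: "strict_mono (\<beta> :: nat \<Rightarrow> nat)"
  shows "\<beta> ` B \<in> sch p"
proof -
  have inj: "inj_on \<tau> B" by (rule strict_mono_on_imp_inj_on[OF strict_mono_onI]) (rule lt)
  have "\<tau> ` B \<in> sch p" by (rule sch_subset[OF T \<tau>(1)])
  then have "(\<lambda>t. \<beta> (inv_into B \<tau> t)) ` \<tau> ` B \<in> sch p"
  proof (rule sch_spread)
    fix t assume "t \<in> \<tau> ` B"
    then obtain m where m: "m \<in> B" "t = \<tau> m" by blast
    then show "t \<le> \<beta> (inv_into B \<tau> t)" using \<tau>(2)[OF m(1)] by (simp add: inv_into_f_f[OF inj])
  next
    fix t t' assume "t \<in> \<tau> ` B" "t' \<in> \<tau> ` B" "t < t'"
    then obtain m m' where m: "m \<in> B" "t = \<tau> m" "m' \<in> B" "t' = \<tau> m'" by blast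
    then have "m < m'" using lt[of m' m] \<open>t < t'\<close> by (cases m m' rule: linorder_cases) auto
    then show "\<beta> (inv_into B \<tau> t) < \<beta> (inv_into B \<tau> t')"
      using m strict_monoD[OF \<beta>] by (simp add: inv_into_f_f[OF inj])
  qed
  moreover have "(\<lambda>t. \<beta> (inv_into B \<tau> t)) ` \<tau> ` B = \<beta> ` B"
    by (simp add: image_image inv_into_f_f[OF inj])
  ultimately show ?thesis by simp
qed

section \<open>Repeated averages\<close>

text \<open>These are special convex combinations: weights on a set of order \<open>p + 1\<close>
  that are nearly invisible to sets of order \<open>p\<close>. Test sets are measured through
  \<open>\<beta>\<close> because \<open>m\<close> will number a block ending at
  \<open>\<beta> m\<close>, and cut blocks are counted by such positions.\<close>

definition average :: "(nat \<Rightarrow> nat) \<Rightarrow> nat \<Rightarrow> real \<Rightarrow> nat set \<Rightarrow> (nat \<Rightarrow> real) \<Rightarrow> bool" where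
  "average \<beta> p \<epsilon> A a \<longleftrightarrow> A \<in> sch (Suc p) \<and> (\<forall>m. 0 \<le> a m) \<and> (\<forall>m. m \<notin> A \<longrightarrow> a m = 0) \<and>
     sum a A = 1 \<and> (\<forall>B. finite B \<longrightarrow> \<beta> ` B \<in> sch p \<longrightarrow> sum a B \<le> \<epsilon>)"

lemma averageD:
  assumes "average \<beta> p \<epsilon> A a"
  shows "A \<in> sch (Suc p)" "finite A" "A \<noteq> {}" "0 \<le> a m" "m \<notin> A \<Longrightarrow> a m = 0" "sum a A = 1"
    "finite B \<Longrightarrow> \<beta> ` B \<in> sch p \<Longrightarrow> sum a B \<le> \<epsilon>"
  using assms finite_sch[of A "Suc p"] by (auto simp: average_def)

lemma average_sum_le_1:
  assumes "average \<beta> p \<epsilon> A a" "finite B"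
  shows "sum a B \<le> 1"
proof -
  have "sum a B = sum a (B \<inter> A)"
    using averageD(5)[OF assms(1)] assms(2) by (intro sum.mono_neutral_right) auto
  also have "\<dots> \<le> sum a A"
    using averageD(2,4)[OF assms(1)] by (intro sum_mono2) auto
  finally show ?thesis using averageD(6)[OF assms(1)] by simp
qed

text \<open>The tolerance may depend on \<open>N k\<close>, where the next support may begin and
  which is known only after the earlier supports are fixed. The induction in
  \<open>average_exists\<close> relies on this dependence.\<close>

lemma average_sequence:
  assumes ex: "\<And>\<epsilon> N. 0 < \<epsilon> \<Longrightarrow> \<exists>A a. average \<beta> p \<epsilon> A a \<and> A \<subseteq> {N..}"
    and pos: "\<And>k N. 0 < eps k N"
  shows "\<exists>A a N. N 0 = N0 \<and> mono N \<and>
    (\<forall>k::nat. average \<beta> p (eps k (N k)) (A k) (a k) \<and> A k \<subseteq> {N k..<N (Suc k)})"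
proof -
  have "\<forall>k N. \<exists>A a. average \<beta> p (eps k N) A a \<and> A \<subseteq> {N..}" using ex pos by blast
  then obtain A a where A: "\<And>k N. average \<beta> p (eps k N) (A k N) (a k N) \<and> A k N \<subseteq> {N..}" by metis
  define N where "N = rec_nat N0 (\<lambda>k Nk. Suc (Max (A k Nk)))"
  have N: "N 0 = N0" "N (Suc k) = Suc (Max (A k (N k)))" for k by (simp_all add: N_def)
  have sub: "A k (N k) \<subseteq> {N k..<N (Suc k)}" for k
  proof
    fix m assume m: "m \<in> A k (N k)"
    then have "m \<le> Max (A k (N k))" using averageD(2) A by (intro Max_ge) blast+
    then show "m \<in> {N k..<N (Suc k)}" using A m N(2)[of k] by fastforce
  qed
  have "N k \<le> N (Suc k)" for k
  proof -
    obtain m where "m \<in> A k (N k)" using averageD(3) A by blast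
    then show ?thesis using sub[of k] by fastforce
  qed
  then have "mono N" by (rule incseq_SucI)
  then show ?thesis using N(1) sub A
    by (intro exI[of _ "\<lambda>k. A k (N k)"] exI[of _ "\<lambda>k. a k (N k)"] exI[of _ N]) simp
qed

text \<open>If a set meets the supports of successive averages, then its size in the next Schreier
  family is bounded by the first support it meets, and the later averages were chosen small
  relative to that; so only one of the \<open>n\<close> averages contributes.\<close>

lemma average_exists:
  assumes \<beta>: "strict_mono (\<beta> :: nat \<Rightarrow> nat)" and "0 < \<epsilon>"
  shows "\<exists>A a. average \<beta> p \<epsilon> A a \<and> A \<subseteq> {N..}"
  using \<open>0 < \<epsilon>\<close>
proof (induction p arbitrary: \<epsilon> N)
  case 0
  define n where "n = Suc (nat \<lceil>1 / \<epsilon>\<rceil>)"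
  have n0: "0 < n" by (simp add: n_def)
  have n: "1 / n \<le> \<epsilon>"
  proof -
    have "1 / \<epsilon> \<le> n" unfolding n_def by linarith
    then show ?thesis using 0 n0 by (simp add: field_simps)
  qed
  define M where "M = max N n"
  define A where "A = {M..<M + n}"
  define a :: "nat \<Rightarrow> real" where "a m = (if m \<in> A then 1 / n else 0)" for m
  have "sum a B \<le> \<epsilon>" if "\<beta> ` B \<in> sch 0" for B
  proof (cases "B = {}")
    case False
    with that obtain t where "\<beta> ` B = {t}" by (auto simp: sch_0)
    then obtain m where "B = {m}"
      using False strict_mono_eq[OF \<beta>] by (metis image_insert insert_absorb is_singletonI is_singletonI' is_singleton_the_elem singletonD image_eqI)
    then show ?thesis using n 0 by (simp add: a_def)
  qed (use 0 in simp)
  moreover have "A \<in> sch (Suc 0)" unfolding A_def by (rule sch_interval) (auto simp: M_def)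
  moreover have "sum a A = 1" using n0 by (simp add: a_def A_def)
  ultimately have "average \<beta> 0 \<epsilon> A a" by (auto simp: average_def a_def)
  then show ?case by (auto simp: A_def M_def)
next
  case (Suc p)
  \<comment> \<open>Over the \<open>n\<close> averages a test set collects mass at most 2: at most 1
    from the first average that it meets, and at most \<open>1 / n\<close> from each of the others.
    Averaging divides this by \<open>n\<close>.\<close>
  define n where "n = Suc (nat \<lceil>2 / \<epsilon>\<rceil>)"
  have n0: "0 < n" by (simp add: n_def)
  have n: "2 / n \<le> \<epsilon>"
  proof -
    have "2 / \<epsilon> \<le> n" unfolding n_def by linarith
    then show ?thesis using Suc.prems n0 by (simp add: field_simps)
  qed
  \<comment> \<open>A test set of order \<open>p + 1\<close> containing \<open>m0\<close> splits
    into at most \<open>Suc (\<beta> m0)\<close> sets of order \<open>p\<close>. For an average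
    starting at \<open>K > m0\<close> this tolerance limits their total mass to
    \<open>1 / n\<close>.\<close>
  define eps where "eps k K = 1 / (real n * real (Suc (\<beta> K)))" for k K :: nat
  have "\<exists>A a K. K 0 = max N n \<and> mono K \<and>
    (\<forall>k. average \<beta> p (eps k (K k)) (A k) (a k) \<and> A k \<subseteq> {K k..<K (Suc k)})"
    by (rule average_sequence[OF Suc.IH]) (use n0 in \<open>simp_all add: eps_def\<close>)
  then
  obtain A a K where K0: "K 0 = max N n" and K: "mono K"
    and av: "\<And>k. average \<beta> p (eps k (K k)) (A k) (a k)" and sub: "\<And>k. A k \<subseteq> {K k..<K (Suc k)}"
    by metis
  define AA where "AA = (\<Union>i<n. A i)"
  define aa where "aa m = (\<Sum>i<n. a i m) / n" for m
  have fin: "finite AA" unfolding AA_def using averageD(2)[OF av] by blast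
  have geK: "max N n \<le> x" if "x \<in> A i" for x i
    using sub[of i] that monoD[OF K, of 0 i] K0 by auto
  have "AA \<in> sch (Suc (Suc p))"
    unfolding AA_def
  proof (rule sch_SucI)
    fix i k x y assume "i < k" "x \<in> A i" "y \<in> A k"
    then have "x < K (Suc i)" "K (Suc i) \<le> K k" "K k \<le> y"
      using sub[of i] sub[of k] monoD[OF K, of "Suc i" k] by auto
    then show "x < y" by linarith
  next
    fix i t assume "t \<in> A i" then show "n \<le> Suc t" using geK[of t i] by simp
  qed (use averageD(1)[OF av] in blast)
  moreover have "AA \<subseteq> {N..}" using geK unfolding AA_def by fastforce
  moreover have "0 \<le> aa m" for m using averageD(4)[OF av] by (simp add: aa_def sum_nonneg)
  moreover have "aa m = 0" if "m \<notin> AA" for m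
    using averageD(5)[OF av] that by (simp add: aa_def AA_def)
  moreover have sum_aa: "sum aa B = (\<Sum>i<n. sum (a i) B) / n" for B
    unfolding aa_def sum_divide_distrib[symmetric] by (subst sum.swap) simp
  have "sum aa AA = 1"
  proof -
    have "sum (a i) AA = 1" if "i < n" for i
    proof -
      have "sum (a i) AA = sum (a i) (A i)"
        using averageD(5)[OF av[of i]] that fin by (intro sum.mono_neutral_right) (auto simp: AA_def)
      then show ?thesis using averageD(6)[OF av[of i]] by simp
    qed
    then show ?thesis using n0 by (simp add: sum_aa)
  qed
  moreover have "sum aa B \<le> \<epsilon>" if finB: "finite B" and B: "\<beta> ` B \<in> sch (Suc p)" for B
  proof -
    have "(\<Sum>i<n. sum (a i) B) \<le> 2"
    proof (cases "\<exists>i. B \<inter> A i \<noteq> {}")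
      case False
      then have "sum (a i) B = 0" for i
        using averageD(5)[OF av[of i]] by (intro sum.neutral) blast
      then show ?thesis by simp
    next
      case True
      define i0 where "i0 = (LEAST i. B \<inter> A i \<noteq> {})"
      have "B \<inter> A i0 \<noteq> {}" unfolding i0_def using True by (rule LeastI_ex)
      then obtain m0 where m0: "m0 \<in> B" "m0 \<in> A i0" by auto
      from m0 have ne: "\<beta> ` B \<noteq> {}" by auto
      obtain nB F where F: "\<beta> ` B = (\<Union>j<nB. F j)" "\<And>j. j < nB \<Longrightarrow> F j \<in> sch p"
        "\<And>t. t \<in> \<beta> ` B \<Longrightarrow> nB \<le> Suc t"
        by (rule sch_SucE[OF B ne]) (rule that)
      have nB: "nB \<le> Suc (\<beta> m0)" using F(3)[of "\<beta> m0"] m0 by simp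
      have bd: "sum (a i) B \<le> (if i = i0 then 1 else 0) + 1 / n" for i
      proof -
        consider "i < i0" | "i = i0" | "i0 < i" by linarith
        then show ?thesis
        proof cases
          case 1
          then have "B \<inter> A i = {}" unfolding i0_def by (metis not_less_Least)
          then have "sum (a i) B = 0"
            using averageD(5)[OF av[of i]] by (intro sum.neutral) blast
          then show ?thesis by simp
        next
          case 2
          have "0 \<le> 1 / real n" by simp
          then show ?thesis using average_sum_le_1[OF av finB, of i0] 2
            by (simp only: if_True refl)
        next
          case 3
          have "sum (a i) B \<le> (\<Sum>m\<in>B. \<Sum>j<nB. if \<beta> m \<in> F j then a i m else 0)"
          proof (rule sum_mono)
            fix m assume "m \<in> B"
            then obtain j where j: "j < nB" "\<beta> m \<in> F j" using F(1) by blast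
            then have "a i m = (\<Sum>j\<in>{j}. if \<beta> m \<in> F j then a i m else 0)" by simp
            also have "\<dots> \<le> (\<Sum>j<nB. if \<beta> m \<in> F j then a i m else 0)"
              using j averageD(4)[OF av[of i]] by (intro sum_mono2) auto
            finally show "a i m \<le> (\<Sum>j<nB. if \<beta> m \<in> F j then a i m else 0)" .
          qed
          also have "\<dots> = (\<Sum>j<nB. sum (a i) {m \<in> B. \<beta> m \<in> F j})"
            by (subst sum.swap) (simp add: sum.inter_filter[OF finB])
          also have "\<dots> \<le> (\<Sum>j<nB. eps i (K i))"
          proof (rule sum_mono)
            fix j assume "j \<in> {..<nB}"
            then have "\<beta> ` {m \<in> B. \<beta> m \<in> F j} \<in> sch p"
              by (intro sch_subset[OF F(2)[of j]]) auto
            then show "sum (a i) {m \<in> B. \<beta> m \<in> F j} \<le> eps i (K i)"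
              using finB by (intro averageD(7)[OF av[of i]]) auto
          qed
          also have "\<dots> = nB * eps i (K i)" by simp
          also have "\<dots> \<le> 1 / n"
          proof -
            have "m0 < K i"
              using m0 sub[of i0] monoD[OF K, of "Suc i0" i] 3 by auto
            then have "\<beta> m0 < \<beta> (K i)" by (rule strict_monoD[OF \<beta>])
            then have "nB \<le> Suc (\<beta> (K i))" using nB by linarith
            then have "real nB / real (Suc (\<beta> (K i))) \<le> 1" by (simp del: of_nat_Suc)
            then have "real nB / real (Suc (\<beta> (K i))) / n \<le> 1 / n" by (rule divide_right_mono) simp
            then show ?thesis by (simp add: eps_def mult.commute del: of_nat_Suc)
          qed
          finally show ?thesis using 3 by simp
        qed
      qed
      have "(\<Sum>i<n. sum (a i) B) \<le> (\<Sum>i<n. (if i = i0 then 1 else 0) + 1 / n)"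
        by (intro sum_mono bd)
      also have "\<dots> \<le> 2" using n0 by (simp add: sum.distrib)
      finally show ?thesis .
    qed
    then have "sum aa B \<le> 2 / n" unfolding sum_aa by (intro divide_right_mono) auto
    then show ?thesis using n by linarith
  qed
  ultimately have "average \<beta> (Suc p) \<epsilon> AA aa \<and> AA \<subseteq> {N..}" by (simp add: average_def)
  then show ?case by blast
qed

section \<open>Bimonotone bases and blocks\<close>

definition intervals :: "(nat \<Rightarrow> nat) \<Rightarrow> (nat \<Rightarrow> nat) \<Rightarrow> bool" where
  "intervals \<alpha> \<beta> \<longleftrightarrow> (\<forall>i. \<alpha> i \<le> \<beta> i \<and> \<beta> i < \<alpha> (Suc i))"

lemma intervalsD:
  assumes "intervals \<alpha> \<beta>"
  shows "\<alpha> i \<le> \<beta> i" "\<beta> i < \<alpha> (Suc i)" "strict_mono \<alpha>" "strict_mono \<beta>" "i \<le> \<alpha> i" "i < k \<Longrightarrow> \<beta> i < \<alpha> k"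
proof -
  have ab: "\<alpha> i \<le> \<beta> i" "\<beta> i < \<alpha> (Suc i)" for i using assms by (auto simp: intervals_def)
  then show "\<alpha> i \<le> \<beta> i" "\<beta> i < \<alpha> (Suc i)" by auto
  show sa: "strict_mono \<alpha>" using ab by (intro strict_mono_Suc_iff[THEN iffD2]) (meson order_le_less_trans)
  show "strict_mono \<beta>" using ab by (intro strict_mono_Suc_iff[THEN iffD2]) (meson order_less_le_trans)
  show "i \<le> \<alpha> i" using sa by (rule strict_mono_imp_increasing)
  show "\<beta> i < \<alpha> k" if "i < k"
    using ab(2)[of i] monoD[OF strict_mono_mono[OF sa], of "Suc i" k] that by simp
qed

lemma block_basisE:
  assumes "block_basis e u"
  obtains \<sigma> \<omega> a where "intervals \<sigma> \<omega>" "\<And>i. u i = (\<Sum>m=\<sigma> i..\<omega> i. a i m *\<^sub>R e m)" "\<And>i. u i \<noteq> 0"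
proof -
  obtain F a where F: "\<And>n. finite (F n)" "\<And>n. F n \<noteq> {}" "\<And>n. set_less (F n) (F (Suc n))"
    and u: "\<And>n. u n = (\<Sum>i\<in>F n. a i *\<^sub>R e i)" "\<And>n. u n \<noteq> 0"
    using assms unfolding block_basis_def by metis
  show thesis
  proof (rule that)
    show "intervals (\<lambda>n. Min (F n)) (\<lambda>n. Max (F n))"
      using F(1,2) F(3) unfolding intervals_def set_less_def by (simp add: Min_le_iff)
    show "u n = (\<Sum>m=Min (F n)..Max (F n). (if m \<in> F n then a m else 0) *\<^sub>R e m)" for n
      unfolding u by (rule sum.mono_neutral_cong_left) (auto simp: F)
  qed (rule u)
qed

text \<open>Fixed coordinate functionals make the interval projections linear maps, and identities
  between these are checked coefficient by coefficient with \<open>coeff_eqI\<close>.\<close>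

locale bimonotone_biorthogonal =
  fixes e :: "nat \<Rightarrow> 'a::real_normed_vector" and f :: "nat \<Rightarrow> ('a \<Rightarrow>\<^sub>L real)"
  assumes norm_e: "norm (e n) = 1"
    and biorth: "blinfun_apply (f m) (e n) = (if m = n then 1 else 0)"
    and expansion: "(\<lambda>n. blinfun_apply (f n) x *\<^sub>R e n) sums x"
    and bimonotone: "norm (\<Sum>i=m..n. blinfun_apply (f i) x *\<^sub>R e i) \<le> norm x"
begin

definition proj :: "nat \<Rightarrow> nat \<Rightarrow> 'a \<Rightarrow> 'a" where
  "proj m n x = (\<Sum>i=m..n. blinfun_apply (f i) x *\<^sub>R e i)"

lemma norm_proj_le: "norm (proj m n x) \<le> norm x"
  using bimonotone by (simp add: proj_def)

lemma coeff_proj: "blinfun_apply (f i) (proj m n x) = (if m \<le> i \<and> i \<le> n then blinfun_apply (f i) x else 0)"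
  by (simp add: proj_def blinfun.sum_right blinfun.scaleR_right biorth if_distrib[of "(*) _"] cong: if_cong)

lemma coeff_eqI: "(\<And>i. blinfun_apply (f i) x = blinfun_apply (f i) y) \<Longrightarrow> x = y"
  using expansion[of x] expansion[of y] by (simp add: sums_unique2)

lemma linear_proj: "linear (proj m n)"
  by (rule linearI) (simp_all add: proj_def blinfun.add_right blinfun.scaleR_right
      scaleR_add_left sum.distrib scaleR_sum_right)

lemmas proj_add = linear_add[OF linear_proj]
  and proj_scaleR = linear_scale[OF linear_proj]
  and proj_sum = linear_sum[OF linear_proj]
  and proj_zero [simp] = linear_0[OF linear_proj]

lemma proj_proj: "proj a b (proj c d x) = proj (max a c) (min b d) x"
  by (rule coeff_eqI) (auto simp: coeff_proj)

lemma proj_sub: "c \<le> a \<Longrightarrow> b \<le> d \<Longrightarrow> proj a b (proj c d x) = proj a b x"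
  by (simp add: proj_proj max_absorb1 min_absorb1)

lemma norm_proj_mono: "c \<le> a \<Longrightarrow> b \<le> d \<Longrightarrow> norm (proj a b x) \<le> norm (proj c d x)"
  by (metis proj_sub norm_proj_le)

lemma proj_empty: "n < m \<Longrightarrow> proj m n x = 0"
  by (simp add: proj_def)

lemma proj_tendsto: "(\<lambda>n. proj 0 n x) \<longlonglongrightarrow> x"
  using expansion[of x] by (simp add: sums_def_le proj_def flip: atMost_atLeast0)

definition supported :: "nat \<Rightarrow> nat \<Rightarrow> 'a \<Rightarrow> bool" where
  "supported m n x \<longleftrightarrow> (\<forall>i. blinfun_apply (f i) x \<noteq> 0 \<longrightarrow> m \<le> i \<and> i \<le> n)"

lemma supported_coeff: "supported m n x \<Longrightarrow> i < m \<or> n < i \<Longrightarrow> blinfun_apply (f i) x = 0"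
  by (force simp: supported_def)

lemma supported_proj: "supported m n (proj m n x)"
  by (simp add: supported_def coeff_proj)

lemma supported_mono: "supported c d x \<Longrightarrow> a \<le> c \<Longrightarrow> d \<le> b \<Longrightarrow> supported a b x"
  by (force simp: supported_def)

lemma proj_id: "supported c d x \<Longrightarrow> a \<le> c \<Longrightarrow> d \<le> b \<Longrightarrow> proj a b x = x"
  by (rule coeff_eqI) (force simp: coeff_proj supported_def)

lemma proj_disjoint: "supported c d x \<Longrightarrow> b < c \<or> d < a \<Longrightarrow> proj a b x = 0"
  by (rule coeff_eqI) (force simp: coeff_proj supported_def)

lemma supported_e: "supported n n (e n)"
  by (simp add: supported_def biorth)

lemma supported_scaleR: "supported m n x \<Longrightarrow> supported m n (c *\<^sub>R x)"
  by (simp add: supported_def blinfun.scaleR_right)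

lemma block_basisI:
  assumes iv: "intervals \<alpha> \<beta>" and sup: "\<And>i. supported (\<alpha> i) (\<beta> i) (u i)" and nz: "\<And>i. u i \<noteq> 0"
  shows "block_basis e u"
proof -
  \<comment> \<open>\<open>block_basis\<close> asks for one coefficient function for all blocks. At
    most one summand is nonzero at \<open>k\<close>, and a block whose interval contains
    \<open>k\<close> has index at most \<open>k\<close>, so the sum up to \<open>k\<close> finds
    it.\<close>
  define a where "a k = (\<Sum>i\<le>k. blinfun_apply (f k) (u i))" for k
  have a: "a k = blinfun_apply (f k) (u i)" if k: "k \<in> {\<alpha> i..\<beta> i}" for i k
  proof -
    have "blinfun_apply (f k) (u i') = 0" if "i' \<noteq> i" for i'
    proof (rule supported_coeff[OF sup])
      show "k < \<alpha> i' \<or> \<beta> i' < k"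
        using that k intervalsD(6)[OF iv, of i i'] intervalsD(6)[OF iv, of i' i] by (cases i i' rule: linorder_cases) auto
    qed
    moreover have "i \<le> k" using k intervalsD(5)[OF iv, of i] by simp
    ultimately have "a k = (\<Sum>i'\<in>{i}. blinfun_apply (f k) (u i'))"
      unfolding a_def by (intro sum.mono_neutral_right) auto
    then show ?thesis by simp
  qed
  have "u i = (\<Sum>k\<in>{\<alpha> i..\<beta> i}. a k *\<^sub>R e k)" for i
    using proj_id[OF sup, of "\<alpha> i" i "\<beta> i"] by (simp add: proj_def a)
  moreover have "Max {\<alpha> i..\<beta> i} = \<beta> i" "Min {\<alpha> i..\<beta> i} = \<alpha> i" for i
    using intervalsD(1)[OF iv, of i] by (auto intro: Max_eqI Min_eqI)
  then have "set_less {\<alpha> i..\<beta> i} {\<alpha> (Suc i)..\<beta> (Suc i)}" for i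
    using intervalsD(2)[OF iv, of i] by (simp add: set_less_def)
  ultimately show ?thesis
    unfolding block_basis_def using nz intervalsD(1)[OF iv]
    by (intro exI[of _ "\<lambda>i. {\<alpha> i..\<beta> i}"] exI[of _ a]) simp
qed

lemma asymptotic_l1_blocks:
  assumes asy: "asymptotic_l1 \<delta> \<xi> e" and iv: "intervals \<alpha> \<beta>" and sup: "\<And>i. supported (\<alpha> i) (\<beta> i) (w i)"
    and F: "F \<in> sch \<xi>"
  shows "\<delta> * (\<Sum>i\<in>F. norm (w i)) \<le> norm (\<Sum>i\<in>F. w i)"
proof -
  \<comment> \<open>A zero term is replaced by a basis vector from its interval, which keeps the
    sequence a normalized block basis; the coefficient \<open>norm (w i)\<close> of this term is
    0.\<close>
  define u where "u i = (if w i = 0 then e (\<alpha> i) else (1 / norm (w i)) *\<^sub>R w i)" for i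
  have nu: "norm (u i) = 1" for i by (simp add: u_def norm_e)
  have "supported (\<alpha> i) (\<beta> i) (u i)" for i
    using sup intervalsD(1)[OF iv] supported_mono[OF supported_e] by (simp add: u_def supported_scaleR)
  moreover have "u i \<noteq> 0" for i using nu[of i] by auto
  ultimately have "block_basis e u" using iv by (intro block_basisI)
  then have "l1_spreading_model \<delta> \<xi> u"
    using asy nu by (simp add: asymptotic_l1_def normalized_seq_def)
  then have "\<forall>F a. Suc ` F \<in> schreier \<xi> \<longrightarrow> \<delta> * (\<Sum>i\<in>F. \<bar>a i\<bar>) \<le> norm (\<Sum>i\<in>F. a i *\<^sub>R u i)"
    by (simp add: l1_spreading_model_def)
  from this[rule_format, of F "\<lambda>i. norm (w i)"]
  have "\<delta> * (\<Sum>i\<in>F. \<bar>norm (w i)\<bar>) \<le> norm (\<Sum>i\<in>F. norm (w i) *\<^sub>R u i)"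
    using F by (simp add: sch_def)
  moreover have "norm (w i) *\<^sub>R u i = w i" for i by (simp add: u_def)
  ultimately show ?thesis by simp
qed

lemma asymptotic_l1_pos: "asymptotic_l1 \<delta> \<xi> e \<Longrightarrow> 0 < \<delta>"
proof -
  assume asy: "asymptotic_l1 \<delta> \<xi> e"
  have "e n \<noteq> 0" for n using norm_e[of n] by auto
  then have "block_basis e e"
    by (intro block_basisI[of "\<lambda>i. i" "\<lambda>i. i"]) (simp_all add: intervals_def supported_e)
  with asy norm_e show ?thesis by (auto simp: asymptotic_l1_def normalized_seq_def l1_spreading_model_def)
qed

lemma proj_telescope:
  assumes "strict_mono b"
  shows "p \<le> q \<Longrightarrow> (\<Sum>i=p..q. proj (b i) (b (Suc i) - 1) x) = proj (b p) (b (Suc q) - 1) x"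
proof (induction q rule: dec_induct)
  case (step q)
  have 1: "b p < b (Suc q)" "b (Suc q) < b (Suc (Suc q))"
    using assms step(1) by (auto simp: strict_mono_def)
  have "{b p..b (Suc (Suc q)) - 1} = {b p..b (Suc q) - 1} \<union> {b (Suc q)..b (Suc (Suc q)) - 1}"
    "{b p..b (Suc q) - 1} \<inter> {b (Suc q)..b (Suc (Suc q)) - 1} = {}"
    using 1 by auto
  then show ?case using step by (simp add: proj_def sum.union_disjoint)
qed simp

text \<open>The tiles from \<open>p\<close> to \<open>q\<close> add up to one interval projection of
  \<open>x\<close>, and by \<open>zero\<close> only those in \<open>F\<close> contribute. Hence the
  sum in the spreading model estimate has norm at most \<open>norm x\<close>.\<close>

lemma asymptotic_l1_tiling:
  assumes asy: "asymptotic_l1 \<delta> \<xi> e" and b: "strict_mono b" and F: "F \<in> sch \<xi>"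
    and Fpq: "F \<subseteq> {p..q}" and zero: "\<And>i. i \<in> {p..q} - F \<Longrightarrow> proj (b i) (b (Suc i) - 1) x = 0"
  shows "\<delta> * (\<Sum>i\<in>F. norm (proj (b i) (b (Suc i) - 1) x)) \<le> norm x"
proof (cases "p \<le> q")
  case True
  have bS: "b i < b (Suc i)" for i using b by (simp add: strict_mono_def)
  have "intervals b (\<lambda>i. b (Suc i) - 1)"
    unfolding intervals_def
  proof
    fix i show "b i \<le> b (Suc i) - 1 \<and> b (Suc i) - 1 < b (Suc i)" using bS[of i] by auto
  qed
  from asymptotic_l1_blocks[OF asy this supported_proj F]
  have "\<delta> * (\<Sum>i\<in>F. norm (proj (b i) (b (Suc i) - 1) x)) \<le> norm (\<Sum>i\<in>F. proj (b i) (b (Suc i) - 1) x)" .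
  also have "(\<Sum>i\<in>F. proj (b i) (b (Suc i) - 1) x) = (\<Sum>i=p..q. proj (b i) (b (Suc i) - 1) x)"
    using Fpq zero by (intro sum.mono_neutral_left) auto
  also have "\<dots> = proj (b p) (b (Suc q) - 1) x" by (rule proj_telescope[OF b True])
  finally show ?thesis using norm_proj_le order.trans by blast
qed (use Fpq in auto)

end

section \<open>The admissible norm\<close>

text \<open>The factor 2 in \<open>2 * t \<le> s t\<close> is what allows \<open>t\<close> to serve as an index of a block basis even
  after a long initial segment before \<open>s t\<close> has been used up by another block; see
  \<open>sparse_lower_bound\<close>.\<close>

definition admissible :: "nat \<Rightarrow> nat set \<Rightarrow> (nat \<Rightarrow> nat) \<Rightarrow> (nat \<Rightarrow> nat) \<Rightarrow> bool" where
  "admissible p T s h \<longleftrightarrow> T \<in> sch p \<and> (\<forall>t\<in>T. 2 * t \<le> s t \<and> s t \<le> h t) \<and>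
     (\<forall>t\<in>T. \<forall>t'\<in>T. t < t' \<longrightarrow> h t < s t')"

definition sparse_intervals :: "(nat \<Rightarrow> nat) \<Rightarrow> (nat \<Rightarrow> nat) \<Rightarrow> bool" where
  "sparse_intervals \<alpha> \<beta> \<longleftrightarrow> intervals \<alpha> \<beta> \<and> (\<forall>m. 2 * m < \<alpha> m \<and> 2 * \<beta> m < \<alpha> (Suc m))"

lemma sparse_intervals_gap:
  assumes "sparse_intervals \<alpha> \<beta>" "m < m'"
  shows "\<beta> m + \<alpha> m' div 2 < \<alpha> m'"
proof -
  have iv: "intervals \<alpha> \<beta>" using assms by (simp add: sparse_intervals_def)
  have "2 * \<beta> m < \<alpha> (Suc m)" using assms by (simp add: sparse_intervals_def)
  also have "\<dots> \<le> \<alpha> m'"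
    using monoD[OF strict_mono_mono[OF intervalsD(3)[OF iv]], of "Suc m" m'] assms(2) by simp
  finally show ?thesis by linarith
qed

lemma sparse_intervals_half:
  assumes "sparse_intervals \<alpha> \<beta>"
  shows "strict_mono (\<lambda>m. \<alpha> m div 2)" "m \<le> \<alpha> m div 2"
proof -
  have sp: "intervals \<alpha> \<beta>" "2 * m < \<alpha> m" "2 * \<beta> m < \<alpha> (Suc m)" for m
    using assms by (auto simp: sparse_intervals_def)
  show "m \<le> \<alpha> m div 2" using sp(2)[of m] by linarith
  show "strict_mono (\<lambda>m. \<alpha> m div 2)"
    unfolding strict_mono_Suc_iff
  proof
    fix m show "\<alpha> m div 2 < \<alpha> (Suc m) div 2"
      using intervalsD(1)[OF sp(1), of m] sp(2)[of m] sp(3)[of m] by linarith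
  qed
qed

context bimonotone_biorthogonal
begin

text \<open>Interval number \<open>i\<close> gets index \<open>s 0 + i\<close>, so the index set is
  a run of at most \<open>Suc (s 0)\<close> integers, of order 1. The space after each interval is
  added to its tile, which can only increase the norm of the projection.\<close>

lemma asymptotic_l1_consecutive:
  assumes asy: "asymptotic_l1 \<delta> \<xi> e" and \<xi>: "1 \<le> \<xi>" and n: "1 \<le> n" "n \<le> Suc (s 0)"
    and sh: "\<And>i. i < n \<Longrightarrow> s i \<le> h i" and hs: "\<And>i. Suc i < n \<Longrightarrow> h i < s (Suc i)"
  shows "\<delta> * (\<Sum>i<n. norm (proj (s i) (h i) x)) \<le> norm x"
proof -
  \<comment> \<open>Single positions fill the indices below \<open>s 0\<close> and those after the
    last interval, whose tile ends exactly at \<open>h (n - 1)\<close>.\<close>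
  define b where "b k = (if k < s 0 then k else if k < s 0 + n then s (k - s 0)
    else Suc (h (n - 1)) + (k - s 0 - n))" for k
  have b_in: "b (s 0 + i) = s i" if "i < n" for i using that by (simp add: b_def)
  have b_next: "h i < b (Suc (s 0 + i))" if "i < n" for i
  proof (cases "Suc i < n")
    case True
    then show ?thesis using b_in[of "Suc i"] hs[of i] by simp
  next
    case False
    then have "n = Suc i" using that by simp
    then show ?thesis by (simp add: b_def)
  qed
  have "strict_mono b"
    unfolding strict_mono_Suc_iff
  proof
    fix k
    consider "Suc k < s 0" | "Suc k = s 0" | i where "i < n" "k = s 0 + i" | "s 0 + n \<le> k"
      by (metis add_diff_inverse_nat less_diff_conv2 linorder_not_less not_less_eq nat_neq_iff le_add1 add.commute)
    then show "b k < b (Suc k)"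
    proof cases
      case 2
      then show ?thesis using n b_in[of 0] by (simp add: b_def)
    next
      case 3
      then show ?thesis using b_in[of i] b_next[of i] sh[of i] by simp
    qed (auto simp: b_def)
  qed
  moreover have "{s 0..<s 0 + n} \<in> sch \<xi>" by (rule sch_interval) (use n \<xi> in auto)
  ultimately have "\<delta> * (\<Sum>k\<in>{s 0..<s 0 + n}. norm (proj (b k) (b (Suc k) - 1) x)) \<le> norm x"
    by (rule asymptotic_l1_tiling[OF asy, where p = "s 0" and q = "s 0 + n - 1"]) (use n in auto)
  moreover have "(\<Sum>i<n. norm (proj (s i) (h i) x)) \<le> (\<Sum>k\<in>{s 0..<s 0 + n}. norm (proj (b k) (b (Suc k) - 1) x))"
  proof -
    have "(\<Sum>i<n. norm (proj (s i) (h i) x)) \<le> (\<Sum>i<n. norm (proj (b (s 0 + i)) (b (Suc (s 0 + i)) - 1) x))"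
    proof (rule sum_mono)
      fix i assume "i \<in> {..<n}"
      then show "norm (proj (s i) (h i) x) \<le> norm (proj (b (s 0 + i)) (b (Suc (s 0 + i)) - 1) x)"
        using b_in[of i] b_next[of i] by (intro norm_proj_mono) auto
    qed
    also have "\<dots> = (\<Sum>k\<in>{s 0..<s 0 + n}. norm (proj (b k) (b (Suc k) - 1) x))"
      by (simp add: sum.atLeastLessThan_shift_0[of _ "s 0"] atLeast0LessThan)
    finally show ?thesis .
  qed
  ultimately show ?thesis
    using mult_left_mono[of _ _ \<delta>] asymptotic_l1_pos[OF asy] by (meson less_imp_le order.trans)
qed

text \<open>Each of the \<open>n\<close> pieces of order \<open>p\<close> is estimated inside the
  hull of its intervals. The hulls are successive, and \<open>n\<close> exceeds the start of the
  first one by at most 1, so the estimate for consecutive indices combines them at the cost of one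
  factor \<open>1 / \<delta>\<close>.\<close>

lemma admissible_bound:
  assumes asy: "asymptotic_l1 \<delta> \<xi> e" and \<xi>: "1 \<le> \<xi>" and "admissible p T s h"
  shows "(\<Sum>t\<in>T. norm (proj (s t) (h t) x)) \<le> (1 / \<delta>) ^ p * norm x"
  using assms(3)
proof (induction p arbitrary: T x)
  case 0
  then have "T = {} \<or> (\<exists>t. T = {t})" by (simp add: admissible_def sch_0)
  then show ?case using norm_proj_le by auto
next
  case (Suc p)
  have \<delta>: "0 < \<delta>" by (rule asymptotic_l1_pos[OF asy])
  show ?case
  proof (cases "T = {}")
    case False
    have T: "T \<in> sch (Suc p)" using Suc.prems by (simp add: admissible_def)
    have sh: "2 * t \<le> s t" "s t \<le> h t" if "t \<in> T" for t using Suc.prems that by (auto simp: admissible_def)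
    have hs: "h t < s t'" if "t \<in> T" "t' \<in> T" "t < t'" for t t' using Suc.prems that by (auto simp: admissible_def)
    obtain n F where F: "T = (\<Union>i<n. F i)" "\<And>i. i < n \<Longrightarrow> F i \<in> sch p" "\<And>t. t \<in> T \<Longrightarrow> n \<le> Suc t"
      "\<And>i k x y. i < k \<Longrightarrow> k < n \<Longrightarrow> x \<in> F i \<Longrightarrow> y \<in> F k \<Longrightarrow> x < y"
      "1 \<le> n" "\<And>i. i < n \<Longrightarrow> F i \<noteq> {}"
      by (rule sch_SucE[OF T False]) (rule that)
    have finF: "finite (F i)" if "i < n" for i using finite_sch F(2) that by blast
    have MinF: "Min (F i) \<in> F i" and MaxF: "Max (F i) \<in> F i" if "i < n" for i
      using finF F(6) that by auto
    have sub: "t \<in> T" if "i < n" "t \<in> F i" for i t using F(1) that by blast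
    define s' where "s' i = s (Min (F i))" for i
    define h' where "h' i = h (Max (F i))" for i
    have mono_s: "s t \<le> s t'" and mono_h: "h t \<le> h t'" if "t \<in> T" "t' \<in> T" "t \<le> t'" for t t'
      using hs[of t t'] sh[of t] sh[of t'] that by (cases "t = t'", auto)+
    have s': "s' i \<le> s t" and h': "h t \<le> h' i" if "i < n" "t \<in> F i" for i t
      unfolding s'_def h'_def using that finF MinF MaxF sub
      by (auto intro!: mono_s mono_h)
    have "(\<Sum>t\<in>T. norm (proj (s t) (h t) x)) = (\<Sum>i<n. \<Sum>t\<in>F i. norm (proj (s t) (h t) x))"
      unfolding F(1)
    proof (rule sum.UNION_disjoint)
      show "\<forall>i\<in>{..<n}. \<forall>j\<in>{..<n}. i \<noteq> j \<longrightarrow> F i \<inter> F j = {}"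
      proof (intro ballI impI)
        fix i j assume "i \<in> {..<n}" "j \<in> {..<n}" "i \<noteq> j"
        then show "F i \<inter> F j = {}"
          using F(4)[of i j] F(4)[of j i] by (cases i j rule: linorder_cases) blast+
      qed
    qed (use finF in auto)
    also have "\<dots> \<le> (\<Sum>i<n. (1 / \<delta>) ^ p * norm (proj (s' i) (h' i) x))"
    proof (rule sum_mono)
      fix i assume "i \<in> {..<n}"
      then have i: "i < n" by simp
      have "(\<Sum>t\<in>F i. norm (proj (s t) (h t) x)) = (\<Sum>t\<in>F i. norm (proj (s t) (h t) (proj (s' i) (h' i) x)))"
        using s'[OF i] h'[OF i] by (intro sum.cong refl) (simp add: proj_sub)
      also have "\<dots> \<le> (1 / \<delta>) ^ p * norm (proj (s' i) (h' i) x)"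
        by (rule Suc.IH) (use F(2)[OF i] sh hs sub[OF i] in \<open>simp add: admissible_def\<close>)
      finally show "(\<Sum>t\<in>F i. norm (proj (s t) (h t) x)) \<le> (1 / \<delta>) ^ p * norm (proj (s' i) (h' i) x)" .
    qed
    also have "\<dots> = (1 / \<delta>) ^ p * (\<Sum>i<n. norm (proj (s' i) (h' i) x))"
      by (simp add: sum_distrib_left)
    also have "\<dots> \<le> (1 / \<delta>) ^ p * (norm x / \<delta>)"
    proof (rule mult_left_mono)
      have "\<delta> * (\<Sum>i<n. norm (proj (s' i) (h' i) x)) \<le> norm x"
      proof (rule asymptotic_l1_consecutive[OF asy \<xi> F(5)])
        have 0: "Min (F 0) \<in> F 0" using MinF[of 0] F(5) by simp
        then have "Min (F 0) \<in> T" using sub[of 0] F(5) by simp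
        then show "n \<le> Suc (s' 0)"
          using F(3)[of "Min (F 0)"] sh(1)[of "Min (F 0)"] by (simp add: s'_def)
        show "s' i \<le> h' i" if "i < n" for i
          using s'[OF that MinF[OF that]] h'[OF that MinF[OF that]] sh(2)[OF sub[OF that MinF[OF that]]] by simp
        show "h' i < s' (Suc i)" if "Suc i < n" for i
          unfolding s'_def h'_def
          using that MinF[of "Suc i"] MaxF[of i] sub[of i "Max (F i)"] sub[of "Suc i" "Min (F (Suc i))"]
            F(4)[of i "Suc i" "Max (F i)" "Min (F (Suc i))"]
          by (intro hs) simp_all
      qed
      then show "(\<Sum>i<n. norm (proj (s' i) (h' i) x)) \<le> norm x / \<delta>"
        using \<delta> by (simp add: field_simps)
    qed (use \<delta> in simp)
    finally show ?thesis by simp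
  qed (use \<delta> in simp)
qed

definition admnorm :: "nat \<Rightarrow> 'a \<Rightarrow> real" where
  "admnorm p x = Sup {\<Sum>t\<in>T. norm (proj (s t) (h t) x) | T s h. admissible p T s h}"

lemma admissible_empty: "admissible p {} s h"
  by (simp add: admissible_def)

context
  fixes \<delta> :: real and \<xi> :: nat
  assumes asy: "asymptotic_l1 \<delta> \<xi> e" and \<xi>: "1 \<le> \<xi>"
begin

lemma admnorm_upper: "admissible p T s h \<Longrightarrow> (\<Sum>t\<in>T. norm (proj (s t) (h t) x)) \<le> admnorm p x"
  unfolding admnorm_def
  by (rule cSup_upper) (auto intro!: bdd_aboveI[of _ "(1 / \<delta>) ^ p * norm x"] admissible_bound[OF asy \<xi>])

lemma admnorm_least:
  "(\<And>T s h. admissible p T s h \<Longrightarrow> (\<Sum>t\<in>T. norm (proj (s t) (h t) x)) \<le> c) \<Longrightarrow> admnorm p x \<le> c"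
  unfolding admnorm_def by (rule cSup_least) (use admissible_empty in blast)+

lemma admnorm_le: "admnorm p x \<le> (1 / \<delta>) ^ p * norm x"
  by (intro admnorm_least admissible_bound[OF asy \<xi>])

lemma admnorm_nonneg: "0 \<le> admnorm p x"
  using admnorm_upper[OF admissible_empty] by simp

lemma admnorm_triangle: "admnorm p (x + y) \<le> admnorm p x + admnorm p y"
proof (rule admnorm_least)
  fix T s h assume adm: "admissible p T s h"
  have "(\<Sum>t\<in>T. norm (proj (s t) (h t) (x + y))) \<le>
      (\<Sum>t\<in>T. norm (proj (s t) (h t) x)) + (\<Sum>t\<in>T. norm (proj (s t) (h t) y))"
    unfolding sum.distrib[symmetric] proj_add by (intro sum_mono norm_triangle_ineq)
  also have "\<dots> \<le> admnorm p x + admnorm p y" by (intro add_mono admnorm_upper adm)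
  finally show "(\<Sum>t\<in>T. norm (proj (s t) (h t) (x + y))) \<le> admnorm p x + admnorm p y" .
qed

lemma admnorm_scaleR: "admnorm p (c *\<^sub>R x) = \<bar>c\<bar> * admnorm p x"
proof (rule antisym)
  have le: "admnorm p (c *\<^sub>R x) \<le> \<bar>c\<bar> * admnorm p x" for c x
  proof (rule admnorm_least)
    fix T s h assume adm: "admissible p T s h"
    show "(\<Sum>t\<in>T. norm (proj (s t) (h t) (c *\<^sub>R x))) \<le> \<bar>c\<bar> * admnorm p x"
      using admnorm_upper[OF adm, of x]
      by (simp add: proj_scaleR sum_distrib_left[symmetric] mult_left_mono)
  qed
  then show "admnorm p (c *\<^sub>R x) \<le> \<bar>c\<bar> * admnorm p x" .
  show "\<bar>c\<bar> * admnorm p x \<le> admnorm p (c *\<^sub>R x)"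
  proof (cases "c = 0")
    case False
    then show ?thesis using le[of "1 / c" "c *\<^sub>R x"] by (simp add: field_simps)
  qed (simp add: admnorm_nonneg)
qed

lemma equivalent_norm_admnorm: "equivalent_norm (\<lambda>x. norm x + admnorm p x)"
  unfolding equivalent_norm_def
proof (intro conjI allI)
  have \<delta>: "0 < \<delta>" by (rule asymptotic_l1_pos[OF asy])
  fix x y :: 'a and c :: real
  show "norm x + admnorm p x = 0 \<longleftrightarrow> x = 0"
    using admnorm_nonneg[of p x] admnorm_scaleR[of p 0 x] by (auto simp: add_nonneg_eq_0_iff)
  show "norm (x + y) + admnorm p (x + y) \<le> norm x + admnorm p x + (norm y + admnorm p y)"
    using norm_triangle_ineq[of x y] admnorm_triangle[of p x y] by simp
  show "norm (c *\<^sub>R x) + admnorm p (c *\<^sub>R x) = \<bar>c\<bar> * (norm x + admnorm p x)"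
    by (simp add: admnorm_scaleR distrib_left)
  show "\<exists>c C. 0 < c \<and> 0 < C \<and> (\<forall>x. c * norm x \<le> norm x + admnorm p x \<and> norm x + admnorm p x \<le> C * norm x)"
    using admnorm_nonneg admnorm_le \<delta>
    by (intro exI[of _ 1] exI[of _ "1 + (1 / \<delta>) ^ p"]) (auto simp: distrib_right add_pos_pos)
qed

text \<open>The gaps of a sparse sequence leave enough room for the piece of \<open>x\<close> starting at
  \<open>\<alpha> \<sigma>\<close> to have index \<open>\<alpha> \<sigma> div 2\<close> in a block basis.\<close>

lemma sparse_lower_bound:
  assumes sp: "sparse_intervals \<alpha> \<beta>" and S: "(\<lambda>m. \<alpha> m div 2) ` S \<in> sch \<xi>"
    and \<omega>: "\<And>\<sigma>. \<sigma> \<in> S \<Longrightarrow> \<sigma> \<le> \<omega> \<sigma>" "\<And>\<sigma> \<tau>. \<sigma> \<in> S \<Longrightarrow> \<tau> \<in> S \<Longrightarrow> \<sigma> < \<tau> \<Longrightarrow> \<omega> \<sigma> < \<tau>"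
    and x: "\<And>i. blinfun_apply (f i) x \<noteq> 0 \<Longrightarrow> \<exists>m. \<alpha> m \<le> i \<and> i \<le> \<beta> m"
  shows "\<delta> * (\<Sum>\<sigma>\<in>S. norm (proj (\<alpha> \<sigma>) (\<beta> (\<omega> \<sigma>)) x)) \<le> norm x"
proof (cases "S = {}")
  case False
  define \<gamma> where "\<gamma> m = \<alpha> m div 2" for m
  have S': "\<gamma> ` S \<in> sch \<xi>" using S by (simp add: \<gamma>_def)
  have iv: "intervals \<alpha> \<beta>" using sp by (simp add: sparse_intervals_def)
  have \<gamma>: "strict_mono \<gamma>" using sparse_intervals_half(1)[OF sp] by (simp add: \<gamma>_def[abs_def])
  have gap: "\<beta> m + \<gamma> m' < \<alpha> m'" if "m < m'" for m m'
    unfolding \<gamma>_def by (rule sparse_intervals_gap[OF sp that])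
  have inj: "inj_on \<gamma> S" using \<gamma> by (simp add: strict_mono_imp_inj_on)
  have finS: "finite S" using finite_sch[OF S'] finite_image_iff[OF inj] by simp
  \<comment> \<open>Index \<open>i\<close> takes the offset of the first element of \<open>S\<close>
    whose \<open>\<gamma>\<close> is at least \<open>i\<close>. Thus
    \<open>\<gamma> \<sigma>\<close> goes to \<open>\<alpha> \<sigma>\<close>, and the skipped
    indices go to single positions just before the start of the next piece. Past the last index, the
    offset \<open>K\<close> exceeds all right ends.\<close>
  define nxt where "nxt i = (LEAST \<sigma>. \<sigma> \<in> S \<and> i \<le> \<gamma> \<sigma>)" for i
  define K where "K = (\<Sum>\<sigma>\<in>S. Suc (\<beta> (\<omega> \<sigma>)))"
  define off where "off i = (if \<exists>\<sigma>\<in>S. i \<le> \<gamma> \<sigma> then \<alpha> (nxt i) - \<gamma> (nxt i) else K)" for i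
  define b where "b i = i + off i" for i
  have nxt: "nxt i \<in> S" "i \<le> \<gamma> (nxt i)" if "\<exists>\<sigma>\<in>S. i \<le> \<gamma> \<sigma>" for i
    using LeastI_ex[of "\<lambda>\<sigma>. \<sigma> \<in> S \<and> i \<le> \<gamma> \<sigma>"] that unfolding nxt_def by blast+
  have nxt_le: "nxt i \<le> \<sigma>" if "\<sigma> \<in> S" "i \<le> \<gamma> \<sigma>" for i \<sigma>
    unfolding nxt_def using that by (intro Least_le) blast
  have K: "\<beta> (\<omega> \<sigma>) < K" if "\<sigma> \<in> S" for \<sigma>
  proof -
    have "Suc (\<beta> (\<omega> \<sigma>)) \<le> K" unfolding K_def using finS that by (intro member_le_sum) auto
    then show ?thesis by simp
  qed
  have nxt_\<gamma>: "nxt (\<gamma> \<sigma>) = \<sigma>" if "\<sigma> \<in> S" for \<sigma>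
    using nxt_le[OF that order.refl] nxt(2)[of "\<gamma> \<sigma>"] that strict_mono_less_eq[OF \<gamma>] by (meson le_antisym order.refl)
  have b_start: "b (\<gamma> \<sigma>) = \<alpha> \<sigma>" if "\<sigma> \<in> S" for \<sigma>
  proof -
    have "\<gamma> \<sigma> \<le> \<alpha> \<sigma>" by (simp add: \<gamma>_def)
    then show ?thesis using that nxt_\<gamma>[OF that] unfolding b_def off_def by auto
  qed
  have "off i \<le> off (Suc i)" for i
  proof (cases "\<exists>\<sigma>\<in>S. Suc i \<le> \<gamma> \<sigma>")
    case True
    then have i: "\<exists>\<sigma>\<in>S. i \<le> \<gamma> \<sigma>" using Suc_leD by blast
    have "nxt i \<le> nxt (Suc i)" using nxt[OF True] by (intro nxt_le) auto
    then have "\<alpha> (nxt i) \<le> \<alpha> (nxt (Suc i))"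
      by (rule monoD[OF strict_mono_mono[OF intervalsD(3)[OF iv]]])
    then show ?thesis using True i by (simp add: off_def \<gamma>_def)
  next
    case False
    show ?thesis
    proof (cases "\<exists>\<sigma>\<in>S. i \<le> \<gamma> \<sigma>")
      case True
      have "\<alpha> (nxt i) \<le> \<alpha> (\<omega> (nxt i))"
        using \<omega>(1)[OF nxt(1)[OF True]] by (rule monoD[OF strict_mono_mono[OF intervalsD(3)[OF iv]]])
      also have "\<dots> \<le> \<beta> (\<omega> (nxt i))" by (rule intervalsD(1)[OF iv])
      also have "\<dots> < K" by (rule K[OF nxt(1)[OF True]])
      finally have "\<alpha> (nxt i) - \<gamma> (nxt i) \<le> K" by simp
      then show ?thesis using False by (simp add: off_def)
    qed (use False in \<open>simp add: off_def\<close>)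
  qed
  then have b: "strict_mono b" unfolding strict_mono_Suc_iff b_def by (simp add: le_imp_less_Suc)
  have b_end: "\<beta> (\<omega> \<sigma>) < b (Suc (\<gamma> \<sigma>))" if \<sigma>: "\<sigma> \<in> S" for \<sigma>
  proof (cases "\<exists>\<tau>\<in>S. Suc (\<gamma> \<sigma>) \<le> \<gamma> \<tau>")
    case True
    define \<tau> where "\<tau> = nxt (Suc (\<gamma> \<sigma>))"
    have \<tau>: "\<tau> \<in> S" "\<gamma> \<sigma> < \<gamma> \<tau>" using nxt[OF True] by (auto simp: \<tau>_def)
    then have "\<omega> \<sigma> < \<tau>" using \<omega>(2) \<sigma> strict_mono_less[OF \<gamma>] by blast
    from gap[OF this] show ?thesis using True by (simp add: b_def off_def flip: \<tau>_def)
  next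
    case False
    then show ?thesis using K[OF \<sigma>] by (simp add: b_def off_def)
  qed
  have "\<delta> * (\<Sum>i\<in>\<gamma> ` S. norm (proj (b i) (b (Suc i) - 1) x)) \<le> norm x"
  proof (rule asymptotic_l1_tiling[OF asy b S', where p = "Min (\<gamma> ` S)" and q = "Max (\<gamma> ` S)"])
    show "\<gamma> ` S \<subseteq> {Min (\<gamma> ` S)..Max (\<gamma> ` S)}" using finS by auto
    fix i assume i: "i \<in> {Min (\<gamma> ` S)..Max (\<gamma> ` S)} - \<gamma> ` S"
    have "Min (\<gamma> ` S) \<in> \<gamma> ` S" "Max (\<gamma> ` S) \<in> \<gamma> ` S" using finS False by (auto intro!: Min_in Max_in)
    with i obtain \<sigma> \<sigma>' where \<sigma>: "\<sigma> \<in> S" "\<gamma> \<sigma> \<le> i" "\<sigma>' \<in> S" "i \<le> \<gamma> \<sigma>'" by (metis DiffD1 atLeastAtMost_iff imageE)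
    have neq: "\<gamma> \<sigma> \<noteq> i" if "\<sigma> \<in> S" for \<sigma> using i that by blast
    have ex: "\<exists>\<sigma>\<in>S. i \<le> \<gamma> \<sigma>" using \<sigma> by blast
    define \<tau> where "\<tau> = nxt i"
    have \<tau>: "\<tau> \<in> S" "i < \<gamma> \<tau>" using nxt[OF ex] neq[of \<tau>] by (auto simp: \<tau>_def)
    \<comment> \<open>As \<open>i\<close> is not a value of \<open>\<gamma>\<close> on
      \<open>S\<close>, \<open>i\<close> and \<open>Suc i\<close> have the same next element, so
      tile \<open>i\<close> is a single position. It lies in the gap before
      \<open>\<alpha> \<tau>\<close>, where \<open>x\<close> has no coefficient.\<close>
    have "i \<le> \<gamma> \<sigma> \<longleftrightarrow> Suc i \<le> \<gamma> \<sigma>" if "\<sigma> \<in> S" for \<sigma> using neq[OF that] by linarith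
    then have "(\<lambda>\<sigma>. \<sigma> \<in> S \<and> Suc i \<le> \<gamma> \<sigma>) = (\<lambda>\<sigma>. \<sigma> \<in> S \<and> i \<le> \<gamma> \<sigma>)" by blast
    then have "nxt (Suc i) = \<tau>" unfolding \<tau>_def nxt_def by (rule arg_cong)
    moreover have "\<exists>\<sigma>\<in>S. Suc i \<le> \<gamma> \<sigma>" using \<tau> by (auto simp: Suc_le_eq)
    ultimately have bi: "b (Suc i) - 1 = b i" "b i = i + (\<alpha> \<tau> - \<gamma> \<tau>)"
      using ex by (simp_all add: b_def off_def flip: \<tau>_def)
    have "blinfun_apply (f (b i)) x = 0"
    proof (rule ccontr)
      assume "blinfun_apply (f (b i)) x \<noteq> 0"
      then obtain m where m: "\<alpha> m \<le> b i" "b i \<le> \<beta> m" using x by blast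
      have "\<gamma> \<tau> \<le> \<alpha> \<tau>" by (simp add: \<gamma>_def)
      then have "b i < \<alpha> \<tau>" using bi(2) \<tau>(2) by simp
      then have "m < \<tau>" using m(1) strict_mono_less[OF intervalsD(3)[OF iv]] by (meson order_le_less_trans)
      from gap[OF this] m(2) bi(2) show False by simp
    qed
    then show "proj (b i) (b (Suc i) - 1) x = 0" unfolding bi(1) by (simp add: proj_def)
  qed
  moreover have "(\<Sum>\<sigma>\<in>S. norm (proj (\<alpha> \<sigma>) (\<beta> (\<omega> \<sigma>)) x)) \<le>
      (\<Sum>i\<in>\<gamma> ` S. norm (proj (b i) (b (Suc i) - 1) x))"
    unfolding sum.reindex[OF inj] comp_def
  proof (intro sum_mono norm_proj_mono)
    fix \<sigma> assume "\<sigma> \<in> S"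
    then show "b (\<gamma> \<sigma>) \<le> \<alpha> \<sigma>" "\<beta> (\<omega> \<sigma>) \<le> b (Suc (\<gamma> \<sigma>)) - 1"
      using b_start[of \<sigma>] b_end[of \<sigma>] by simp_all
  qed
  ultimately show ?thesis
    using mult_left_mono[of _ _ \<delta>] asymptotic_l1_pos[OF asy] by (meson less_imp_le order.trans)
qed simp

end

end

section \<open>Large vectors and unsplit families\<close>

text \<open>A supremum below \<open>p\<close> excludes \<open>p\<close> itself, so one block basis
  fails along every subsequence. Leaving the subsequence open lets it be chosen later to suit the
  positions.\<close>

lemma l1_index_less_imp:
  assumes "l1_index u c < enat p" "0 < c"
  obtains v where "block_basis u v" "normalized_seq v"
    "\<And>r. strict_mono r \<Longrightarrow> \<exists>F\<in>sch p. \<exists>b. norm (\<Sum>i\<in>F. b i *\<^sub>R v (r i)) < c * (\<Sum>i\<in>F. \<bar>b i\<bar>)"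
proof -
  have "\<not> (\<forall>v. block_basis u v \<and> normalized_seq v \<longrightarrow>
      (\<exists>r :: nat \<Rightarrow> nat. strict_mono r \<and> l1_spreading_model c p (v \<circ> r)))"
  proof
    assume "\<forall>v. block_basis u v \<and> normalized_seq v \<longrightarrow>
      (\<exists>r :: nat \<Rightarrow> nat. strict_mono r \<and> l1_spreading_model c p (v \<circ> r))"
    then have "enat p \<le> l1_index u c" unfolding l1_index_def by (intro Sup_upper) blast
    with assms(1) show False by simp
  qed
  then obtain v where v: "block_basis u v" "normalized_seq v"
    "\<And>r :: nat \<Rightarrow> nat. strict_mono r \<Longrightarrow> \<not> l1_spreading_model c p (v \<circ> r)"
    by blast
  show thesis
  proof (rule that[OF v(1,2)])
    fix r :: "nat \<Rightarrow> nat" assume r: "strict_mono r"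
    have "normalized_seq (v \<circ> r)" using v(2) by (simp add: normalized_seq_def)
    with v(3)[OF r] assms(2) obtain F b where "Suc ` F \<in> schreier p"
      "\<not> c * (\<Sum>i\<in>F. \<bar>b i\<bar>) \<le> norm (\<Sum>i\<in>F. b i *\<^sub>R (v \<circ> r) i)"
      unfolding l1_spreading_model_def by blast
    then show "\<exists>F\<in>sch p. \<exists>b. norm (\<Sum>i\<in>F. b i *\<^sub>R v (r i)) < c * (\<Sum>i\<in>F. \<bar>b i\<bar>)"
      by (intro bexI[of _ F] exI[of _ b]) (auto simp: sch_def)
  qed
qed

lemma intervals_comp:
  assumes "intervals \<alpha> \<beta>" "intervals \<sigma> \<omega>"
  shows "intervals (\<lambda>i. \<alpha> (\<sigma> i)) (\<lambda>i. \<beta> (\<omega> i))"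
  unfolding intervals_def
proof
  fix i
  have "\<alpha> (\<sigma> i) \<le> \<alpha> (\<omega> i)"
    using monoD[OF strict_mono_mono[OF intervalsD(3)[OF assms(1)]]] intervalsD(1)[OF assms(2)] by blast
  then show "\<alpha> (\<sigma> i) \<le> \<beta> (\<omega> i) \<and> \<beta> (\<omega> i) < \<alpha> (\<sigma> (Suc i))"
    using intervalsD(1)[OF assms(1), of "\<omega> i"] intervalsD(6)[OF assms(1) intervalsD(2)[OF assms(2)], of i]
    by simp
qed

lemma block_basis_spanE:
  assumes "block_basis u v"
  obtains \<sigma> \<omega> where "intervals \<sigma> \<omega>" "\<And>i. v i \<in> span (u ` {\<sigma> i..\<omega> i})" "\<And>i. v i \<noteq> 0"
proof -
  obtain \<sigma> \<omega> a where *: "intervals \<sigma> \<omega>" "\<And>i. v i = (\<Sum>m=\<sigma> i..\<omega> i. a i m *\<^sub>R u m)" "\<And>i. v i \<noteq> 0"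
    using block_basisE[OF assms] by metis
  have "v i \<in> span (u ` {\<sigma> i..\<omega> i})" for i
    unfolding *(2) by (intro span_sum span_scale span_base) auto
  with * show thesis by (intro that)
qed

lemma span_range_sumE:
  fixes u :: "nat \<Rightarrow> 'a::real_vector"
  assumes "x \<in> span (range u)"
  obtains D a where "finite D" "x = (\<Sum>m\<in>D. a m *\<^sub>R u m)"
proof -
  from assms obtain t r where t: "finite t" "t \<subseteq> range u" "x = (\<Sum>v\<in>t. r v *\<^sub>R v)"
    unfolding span_explicit by blast
  from t(2) obtain D where D: "inj_on u D" "t = u ` D" by (auto simp: subset_image_inj)
  have "finite D" using t(1) finite_image_iff[OF D(1)] D(2) by simp
  have "x = (\<Sum>m\<in>D. r (u m) *\<^sub>R u m)" unfolding t(3) D(2) by (simp add: sum.reindex[OF D(1)])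
  with \<open>finite D\<close> show thesis by (rule that)
qed

section \<open>Coordinates in the span of a block sequence\<close>

context bimonotone_biorthogonal
begin

lemma supported_subspace: "subspace {x. supported m n x}"
  unfolding subspace_def supported_def
  by (simp add: blinfun.add_right blinfun.scaleR_right) (metis add.right_neutral)

lemma supported_span:
  assumes iv: "intervals \<alpha> \<beta>" and sup: "\<And>m. supported (\<alpha> m) (\<beta> m) (u m)" and x: "x \<in> span (u ` {k..l})"
  shows "supported (\<alpha> k) (\<beta> l) x"
proof -
  have "u ` {k..l} \<subseteq> {x. supported (\<alpha> k) (\<beta> l) x}"
    using sup supported_mono monoD[OF strict_mono_mono[OF intervalsD(3)[OF iv]]]
      monoD[OF strict_mono_mono[OF intervalsD(4)[OF iv]]] by fastforce
  then show ?thesis using span_minimal[OF _ supported_subspace] x by blast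
qed

lemma proj_block:
  assumes iv: "intervals \<alpha> \<beta>" and sup: "\<And>m. supported (\<alpha> m) (\<beta> m) (u m)"
  shows "proj (\<alpha> m) (\<beta> m) (u k) = (if m = k then u k else 0)"
proof (cases m k rule: linorder_cases)
  case less
  then show ?thesis using proj_disjoint[OF sup] intervalsD(6)[OF iv less] by auto
next
  case equal
  then show ?thesis using proj_id[OF sup] by auto
next
  case greater
  then show ?thesis using proj_disjoint[OF sup] intervalsD(6)[OF iv greater] by auto
qed

lemma proj_block_sum:
  assumes "intervals \<alpha> \<beta>" "\<And>m. supported (\<alpha> m) (\<beta> m) (u m)" "finite D"
  shows "proj (\<alpha> m) (\<beta> m) (\<Sum>k\<in>D. a k *\<^sub>R u k) = (if m \<in> D then a m *\<^sub>R u m else 0)"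
proof -
  have "proj (\<alpha> m) (\<beta> m) (\<Sum>k\<in>D. a k *\<^sub>R u k) = (\<Sum>k\<in>D. if m = k then a k *\<^sub>R u k else 0)"
    by (simp add: proj_sum proj_scaleR proj_block[OF assms(1,2)] if_distrib cong: if_cong)
  then show ?thesis using assms(3) by simp
qed

lemma coeff_abs_le_norm:
  assumes "intervals \<alpha> \<beta>" "\<And>m. supported (\<alpha> m) (\<beta> m) (u m)" "finite D" "m \<in> D" "norm (u m) = 1"
  shows "\<bar>a m\<bar> \<le> norm (\<Sum>k\<in>D. a k *\<^sub>R u k)"
  using norm_proj_le[of "\<alpha> m" "\<beta> m" "\<Sum>k\<in>D. a k *\<^sub>R u k"] assms(4,5)
  by (simp add: proj_block_sum[OF assms(1-3)])

lemma span_block_expansion: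
  assumes iv: "intervals \<alpha> \<beta>" and sup: "\<And>m. supported (\<alpha> m) (\<beta> m) (u m)" and x: "x \<in> span (u ` {k..l})"
  shows "x = (\<Sum>m=k..l. proj (\<alpha> m) (\<beta> m) x)"
  using x
proof (induction rule: span_induct_alt)
  case base
  then show ?case by simp
next
  case (step c x y)
  then obtain j where j: "j \<in> {k..l}" "x = u j" by blast
  have "(\<Sum>m=k..l. proj (\<alpha> m) (\<beta> m) x) = x"
    using j by (simp add: proj_block[OF iv sup])
  then show ?case using step
    by (simp add: proj_add proj_scaleR sum.distrib flip: scaleR_sum_right)
qed

lemma span_block_gaps:
  assumes sup: "\<And>m. supported (\<alpha> m) (\<beta> m) (u m)" and x: "x \<in> span (range u)" and nz: "blinfun_apply (f i) x \<noteq> 0"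
  shows "\<exists>m. \<alpha> m \<le> i \<and> i \<le> \<beta> m"
proof (rule ccontr)
  assume no: "\<not> ?thesis"
  have "blinfun_apply (f i) x = 0"
    using x
  proof (induction rule: span_induct_alt)
    case (step c x y)
    then obtain j where "x = u j" by blast
    then have "blinfun_apply (f i) x = 0" using no supported_coeff[OF sup, of i j] by (meson leI)
    then show ?case using step by (simp add: blinfun.add_right blinfun.scaleR_right)
  qed simp
  with nz show False by simp
qed

context
  fixes \<delta> :: real and \<xi> :: nat
  assumes asy: "asymptotic_l1 \<delta> \<xi> e" and \<xi>: "1 \<le> \<xi>"
begin

lemma exists_large_admnorm:
  assumes iv: "intervals \<alpha> \<beta>" and sup: "\<And>m. supported (\<alpha> m) (\<beta> m) (u m)"
    and idx: "l1_index u c < enat p" and c: "0 < c"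
  shows "\<exists>x\<in>span (range u). x \<noteq> 0 \<and> norm x \<le> c * admnorm p x"
proof -
  obtain v where v: "block_basis u v" "normalized_seq v"
    "\<And>r. strict_mono r \<Longrightarrow> \<exists>F\<in>sch p. \<exists>b. norm (\<Sum>i\<in>F. b i *\<^sub>R v (r i)) < c * (\<Sum>i\<in>F. \<bar>b i\<bar>)"
    by (rule l1_index_less_imp[OF idx c]) (rule that)
  obtain \<sigma> \<omega> where \<sigma>: "intervals \<sigma> \<omega>" "\<And>i. v i \<in> span (u ` {\<sigma> i..\<omega> i})"
    using block_basis_spanE[OF v(1)] by metis
  define s where "s i = \<alpha> (\<sigma> (2 * i))" for i
  define h where "h i = \<beta> (\<omega> (2 * i))" for i
  note ivc = intervals_comp[OF iv \<sigma>(1)]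
  have sv: "supported (\<alpha> (\<sigma> i)) (\<beta> (\<omega> i)) (v i)" for i by (rule supported_span[OF iv sup \<sigma>(2)])
  \<comment> \<open>Taking every second term puts the left end of term \<open>i\<close> at
    \<open>2 * i\<close> or later, as \<open>admissible\<close> demands.\<close>
  have "strict_mono (\<lambda>i::nat. 2 * i)" by (simp add: strict_mono_def)
  from v(3)[OF this] obtain F b where F: "F \<in> sch p"
    and b: "norm (\<Sum>i\<in>F. b i *\<^sub>R v (2 * i)) < c * (\<Sum>i\<in>F. \<bar>b i\<bar>)" by blast
  define x where "x = (\<Sum>i\<in>F. b i *\<^sub>R v (2 * i))"
  have finF: "finite F" by (rule finite_sch[OF F])
  have nv: "norm (v i) = 1" for i using v(2) by (simp add: normalized_seq_def)
  have iv2: "intervals s h"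
    unfolding intervals_def s_def h_def
    using intervalsD(1)[OF ivc] intervalsD(6)[OF ivc, of "2 * i" "2 * Suc i" for i] by simp
  have projx: "proj (s i) (h i) x = b i *\<^sub>R v (2 * i)" if "i \<in> F" for i
    unfolding x_def using proj_block_sum[OF iv2 _ finF, of "\<lambda>i. v (2 * i)"] sv that
    by (simp add: s_def h_def)
  have "admissible p F s h"
    unfolding admissible_def using F intervalsD(1,6)[OF iv2] intervalsD(5)[OF ivc, of "2 * i" for i]
    by (simp add: s_def)
  from admnorm_upper[OF asy \<xi> this, of x] have "(\<Sum>i\<in>F. \<bar>b i\<bar>) \<le> admnorm p x"
    by (simp add: projx nv)
  then have "norm x \<le> c * admnorm p x"
    using b mult_left_mono[of _ _ c] c unfolding x_def[symmetric] by (meson less_imp_le order.trans)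
  moreover have "x \<noteq> 0"
  proof
    assume "x = 0"
    then have "b i = 0" if "i \<in> F" for i using projx[OF that] nv[of "2 * i"] by auto
    then show False using b by simp
  qed
  moreover have "x \<in> span (range u)"
  proof -
    have "v i \<in> span (range u)" for i using \<sigma>(2)[of i] span_mono[of "u ` {\<sigma> i..\<omega> i}" "range u"] by blast
    then show ?thesis unfolding x_def by (intro span_sum span_scale)
  qed
  ultimately show ?thesis by blast
qed

text \<open>Discards from every interval of an admissible family the blocks that it splits. The indices
  of the split blocks form two sets in the Schreier family: those containing the left end of an
  interval and those containing a right end.\<close>

lemma admissible_unsplit:
  assumes sp: "sparse_intervals \<alpha> \<beta>" and x: "x = (\<Sum>m=k..l. proj (\<alpha> m) (\<beta> m) x)"
    and small: "\<And>B. finite B \<Longrightarrow> \<beta> ` B \<in> sch p \<Longrightarrow> (\<Sum>m\<in>B. norm (proj (\<alpha> m) (\<beta> m) x)) \<le> \<eta>"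
    and adm: "admissible p T s h"
  obtains S \<omega> where "S \<subseteq> {k..l}" "(\<lambda>m. \<alpha> m div 2) ` S \<in> sch p"
    "\<And>\<sigma>. \<sigma> \<in> S \<Longrightarrow> \<sigma> \<le> \<omega> \<sigma> \<and> \<omega> \<sigma> \<le> l" "\<And>\<sigma> \<tau>. \<sigma> \<in> S \<Longrightarrow> \<tau> \<in> S \<Longrightarrow> \<sigma> < \<tau> \<Longrightarrow> \<omega> \<sigma> < \<tau>"
    "(\<Sum>t\<in>T. norm (proj (s t) (h t) x)) \<le>
       (\<Sum>\<sigma>\<in>S. norm (proj (\<alpha> \<sigma>) (\<beta> (\<omega> \<sigma>)) x)) + 2 * (1 / \<delta>) ^ p * \<eta>"
proof -
  have iv: "intervals \<alpha> \<beta>" using sp by (simp add: sparse_intervals_def)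
  have \<delta>: "0 < \<delta>" by (rule asymptotic_l1_pos[OF asy])
  have T: "T \<in> sch p" using adm by (simp add: admissible_def)
  have finT: "finite T" by (rule finite_sch[OF T])
  have sh: "2 * t \<le> s t" "s t \<le> h t" if "t \<in> T" for t using adm that by (auto simp: admissible_def)
  have hs: "h t < s t'" if "t \<in> T" "t' \<in> T" "t < t'" for t t' using adm that by (auto simp: admissible_def)
  have mono\<alpha>: "m \<le> m' \<Longrightarrow> \<alpha> m \<le> \<alpha> m'" and mono\<beta>: "m \<le> m' \<Longrightarrow> \<beta> m \<le> \<beta> m'" for m m'
    using strict_mono_mono[OF intervalsD(3)[OF iv]] strict_mono_mono[OF intervalsD(4)[OF iv]]
    by (auto dest: monoD)
  define Q where "Q m = proj (\<alpha> m) (\<beta> m) x" for m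
  have Qsup: "supported (\<alpha> m) (\<beta> m) (Q m)" for m unfolding Q_def by (rule supported_proj)
  have xQ: "x = (\<Sum>m=k..l. Q m)" using x by (simp add: Q_def)
  define M where "M t = {m \<in> {k..l}. s t \<le> \<alpha> m \<and> \<beta> m \<le> h t}" for t
  define B1 where "B1 = {m \<in> {k..l}. \<exists>t\<in>T. \<alpha> m < s t \<and> s t \<le> \<beta> m}"
  define B2 where "B2 = {m \<in> {k..l}. \<exists>t\<in>T. \<alpha> m \<le> h t \<and> h t < \<beta> m}"
  have finM: "finite (M t)" for t unfolding M_def by simp
  have finB: "finite B1" "finite B2" unfolding B1_def B2_def by simp_all

  have B1: "\<beta> ` B1 \<in> sch p"
  proof -
    \<comment> \<open>Each cut block picks an interval whose left end cuts it. The cuts occur in the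
      order of the blocks, so the indices picked increase strictly, and
      \<open>t \<le> s t \<le> \<beta> m\<close> gives the domination. Right ends are treated in the
      same way for \<open>B2\<close>.\<close>
    have "\<forall>m\<in>B1. \<exists>t. t \<in> T \<and> \<alpha> m < s (t) \<and> s (t) \<le> \<beta> m" unfolding B1_def by blast
    from bchoice[OF this] obtain \<tau> where \<tau>: "\<And>m. m \<in> B1 \<Longrightarrow> \<tau> m \<in> T \<and> \<alpha> m < s (\<tau> m) \<and> s (\<tau> m) \<le> \<beta> m" by blast
    show ?thesis
    proof (rule sch_image_dominating[OF T _ _ _ intervalsD(4)[OF iv]])
      show "\<tau> ` B1 \<subseteq> T" using \<tau> by blast
      show "\<tau> m \<le> \<beta> m" if "m \<in> B1" for m using \<tau>[OF that] sh[of "\<tau> m"] by linarith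
      show "\<tau> m < \<tau> m'" if "m \<in> B1" "m' \<in> B1" "m < m'" for m m'
      proof (rule ccontr)
        assume "\<not> \<tau> m < \<tau> m'"
        then have "s (\<tau> m') \<le> s (\<tau> m)"
          using \<tau>[OF that(1)] \<tau>[OF that(2)] hs[of "\<tau> m'" "\<tau> m"] sh(2)[of "\<tau> m'"]
          by (cases "\<tau> m = \<tau> m'") auto
        then show False
          using \<tau>[OF that(1)] \<tau>[OF that(2)] intervalsD(6)[OF iv that(3)] by linarith
      qed
    qed
  qed

  have B2: "\<beta> ` B2 \<in> sch p"
  proof -
    have "\<forall>m\<in>B2. \<exists>t. t \<in> T \<and> \<alpha> m \<le> h (t) \<and> h (t) < \<beta> m" unfolding B2_def by blast
    from bchoice[OF this] obtain \<tau> where \<tau>: "\<And>m. m \<in> B2 \<Longrightarrow> \<tau> m \<in> T \<and> \<alpha> m \<le> h (\<tau> m) \<and> h (\<tau> m) < \<beta> m" by blast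
    show ?thesis
    proof (rule sch_image_dominating[OF T _ _ _ intervalsD(4)[OF iv]])
      show "\<tau> ` B2 \<subseteq> T" using \<tau> by blast
      show "\<tau> m \<le> \<beta> m" if "m \<in> B2" for m using \<tau>[OF that] sh[of "\<tau> m"] by linarith
      show "\<tau> m < \<tau> m'" if "m \<in> B2" "m' \<in> B2" "m < m'" for m m'
      proof (rule ccontr)
        assume "\<not> \<tau> m < \<tau> m'"
        then have "h (\<tau> m') \<le> h (\<tau> m)"
          using \<tau>[OF that(1)] \<tau>[OF that(2)] hs[of "\<tau> m'" "\<tau> m"] sh(2)[of "\<tau> m"]
          by (cases "\<tau> m = \<tau> m'") auto
        then show False
          using \<tau>[OF that(1)] \<tau>[OF that(2)] intervalsD(6)[OF iv that(3)] by linarith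
      qed
    qed
  qed

  have piece: "norm (proj (s t) (h t) x) \<le> norm (\<Sum>m\<in>M t. Q m) + (\<Sum>m\<in>B1 \<union> B2. norm (proj (s t) (h t) (Q m)))"
    if t: "t \<in> T" for t
  proof -
    have Msub: "M t \<subseteq> {k..l}" by (auto simp: M_def)
    have "proj (s t) (h t) x = (\<Sum>m=k..l. proj (s t) (h t) (Q m))"
      by (subst xQ) (rule proj_sum)
    also have "\<dots> = (\<Sum>m\<in>M t. proj (s t) (h t) (Q m)) + (\<Sum>m\<in>{k..l} - M t. proj (s t) (h t) (Q m))"
      by (subst sum.subset_diff[OF Msub]) (simp_all add: add.commute)
    also have "(\<Sum>m\<in>M t. proj (s t) (h t) (Q m)) = (\<Sum>m\<in>M t. Q m)"
      by (intro sum.cong refl proj_id[OF Qsup]) (auto simp: M_def)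
    also have "(\<Sum>m\<in>{k..l} - M t. proj (s t) (h t) (Q m)) = (\<Sum>m\<in>(B1 \<union> B2) - M t. proj (s t) (h t) (Q m))"
    proof (rule sum.mono_neutral_right)
      show "\<forall>m\<in>{k..l} - M t - (B1 \<union> B2 - M t). proj (s t) (h t) (Q m) = 0"
      proof
        fix m assume m: "m \<in> {k..l} - M t - (B1 \<union> B2 - M t)"
        then have "h t < \<alpha> m \<or> \<beta> m < s t" using t by (auto simp: M_def B1_def B2_def not_le not_less)
        then show "proj (s t) (h t) (Q m) = 0" by (rule proj_disjoint[OF Qsup])
      qed
    qed (auto simp: B1_def B2_def)
    finally have "norm (proj (s t) (h t) x) \<le> norm (\<Sum>m\<in>M t. Q m) + norm (\<Sum>m\<in>(B1 \<union> B2) - M t. proj (s t) (h t) (Q m))"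
      by (simp add: norm_triangle_ineq)
    also have "norm (\<Sum>m\<in>(B1 \<union> B2) - M t. proj (s t) (h t) (Q m)) \<le> (\<Sum>m\<in>(B1 \<union> B2) - M t. norm (proj (s t) (h t) (Q m)))"
      by (rule norm_sum)
    also have "\<dots> \<le> (\<Sum>m\<in>B1 \<union> B2. norm (proj (s t) (h t) (Q m)))"
      using finB by (intro sum_mono2) auto
    finally show ?thesis by simp
  qed

  \<comment> \<open>A cut block may meet several intervals. After exchanging the sums, the bound for
    arbitrary admissible families applies to each \<open>Q m\<close>, so all its parts together cost
    at most \<open>(1 / \<delta>) ^ p * norm (Q m)\<close>.\<close>
  have "(\<Sum>t\<in>T. \<Sum>m\<in>B1 \<union> B2. norm (proj (s t) (h t) (Q m))) = (\<Sum>m\<in>B1 \<union> B2. \<Sum>t\<in>T. norm (proj (s t) (h t) (Q m)))"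
    by (rule sum.swap)
  also have "\<dots> \<le> (\<Sum>m\<in>B1 \<union> B2. (1 / \<delta>) ^ p * norm (Q m))"
    by (intro sum_mono admissible_bound[OF asy \<xi> adm])
  also have "\<dots> = (1 / \<delta>) ^ p * (\<Sum>m\<in>B1 \<union> B2. norm (Q m))" by (simp add: sum_distrib_left)
  also have "\<dots> \<le> (1 / \<delta>) ^ p * (\<eta> + \<eta>)"
  proof (rule mult_left_mono)
    have "(\<Sum>m\<in>B1 \<union> B2. norm (Q m)) \<le> (\<Sum>m\<in>B1. norm (Q m)) + (\<Sum>m\<in>B2. norm (Q m))"
      using sum.union_inter[OF finB, of "\<lambda>m. norm (Q m)"] sum_nonneg[of "B1 \<inter> B2" "\<lambda>m. norm (Q m)"] by simp
    also have "\<dots> \<le> \<eta> + \<eta>" unfolding Q_def by (intro add_mono small finB B1 B2)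
    finally show "(\<Sum>m\<in>B1 \<union> B2. norm (Q m)) \<le> \<eta> + \<eta>" .
  qed (use \<delta> in simp)
  finally have err: "(\<Sum>t\<in>T. \<Sum>m\<in>B1 \<union> B2. norm (proj (s t) (h t) (Q m))) \<le> 2 * (1 / \<delta>) ^ p * \<eta>" by simp

  \<comment> \<open>Intervals containing no whole block are dropped; each remaining one is renamed
    by the first block that it contains.\<close>
  define T' where "T' = {t \<in> T. M t \<noteq> {}}"
  define \<sigma> where "\<sigma> t = Min (M t)" for t
  have \<sigma>: "\<sigma> t \<in> M t" "Max (M t) \<in> M t" "\<sigma> t \<le> Max (M t)" if "t \<in> T'" for t
    using that finM[of t] by (auto simp: T'_def \<sigma>_def)
  have Max_less: "Max (M t) < \<sigma> t'" if "t \<in> T'" "t' \<in> T'" "t < t'" for t t'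
  proof (rule ccontr)
    assume "\<not> Max (M t) < \<sigma> t'"
    then have "\<alpha> (\<sigma> t') \<le> \<beta> (Max (M t))" using mono\<alpha>[of "\<sigma> t'" "Max (M t)"] intervalsD(1)[OF iv, of "Max (M t)"] by simp
    moreover have "\<beta> (Max (M t)) \<le> h t" "s t' \<le> \<alpha> (\<sigma> t')" using \<sigma>[OF that(1)] \<sigma>[OF that(2)] by (auto simp: M_def)
    ultimately show False using hs[of t t'] that by (auto simp: T'_def)
  qed
  have \<sigma>_less: "\<sigma> t < \<sigma> t'" if "t \<in> T'" "t' \<in> T'" "t < t'" for t t'
    using Max_less[OF that] \<sigma>(3)[OF that(1)] by simp
  have inj: "inj_on \<sigma> T'" by (rule strict_mono_on_imp_inj_on[OF strict_mono_onI]) (rule \<sigma>_less)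
  define \<omega> where "\<omega> m = Max (M (inv_into T' \<sigma> m))" for m
  have \<omega>: "\<omega> (\<sigma> t) = Max (M t)" if "t \<in> T'" for t using that by (simp add: \<omega>_def inv_into_f_f[OF inj])
  show thesis
  proof (rule that[of "\<sigma> ` T'" \<omega>])
    show "\<sigma> ` T' \<subseteq> {k..l}" using \<sigma>(1) by (auto simp: M_def)
    have "T' \<in> sch p" by (rule sch_subset[OF T]) (auto simp: T'_def)
    then have "(\<lambda>t. \<alpha> (\<sigma> t) div 2) ` T' \<in> sch p"
    proof (rule sch_spread)
      fix t assume t: "t \<in> T'"
      \<comment> \<open>The factor 2 in \<open>admissible\<close> is spent here: \<open>t\<close>
        can be moved right to \<open>\<alpha> (\<sigma> t) div 2\<close>, the index that
        \<open>sparse_lower_bound\<close> can realize.\<close>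
      have "2 * t \<le> \<alpha> (\<sigma> t)" using sh(1)[of t] \<sigma>(1)[OF t] t by (auto simp: M_def T'_def)
      then show "t \<le> \<alpha> (\<sigma> t) div 2" by simp
    next
      fix t t' assume "t \<in> T'" "t' \<in> T'" "t < t'"
      from \<sigma>_less[OF this] show "\<alpha> (\<sigma> t) div 2 < \<alpha> (\<sigma> t') div 2"
        by (rule strict_monoD[OF sparse_intervals_half(1)[OF sp]])
    qed
    then show "(\<lambda>m. \<alpha> m div 2) ` \<sigma> ` T' \<in> sch p" by (simp add: image_image)
    show "m \<le> \<omega> m \<and> \<omega> m \<le> l" if "m \<in> \<sigma> ` T'" for m
      using that \<sigma>(2,3) by (auto simp: \<omega> M_def)
    show "\<omega> m < m'" if "m \<in> \<sigma> ` T'" "m' \<in> \<sigma> ` T'" "m < m'" for m m'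
    proof -
      from that obtain t t' where t: "t \<in> T'" "t' \<in> T'" "m = \<sigma> t" "m' = \<sigma> t'" by blast
      then have "t < t'" using \<sigma>_less[of t' t] that(3) by (cases t t' rule: linorder_cases) auto
      then show ?thesis using Max_less t by (simp add: \<omega>)
    qed
    \<comment> \<open>The whole blocks inside one interval have consecutive numbers, and
      \<open>x\<close> has nothing between blocks, so their sum is a single interval
      projection.\<close>
    have MQ: "(\<Sum>m\<in>M t. Q m) = proj (\<alpha> (\<sigma> t)) (\<beta> (\<omega> (\<sigma> t))) x" if t: "t \<in> T'" for t
    proof -
      have "proj (\<alpha> (\<sigma> t)) (\<beta> (\<omega> (\<sigma> t))) x = (\<Sum>m=k..l. proj (\<alpha> (\<sigma> t)) (\<beta> (Max (M t))) (Q m))"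
        unfolding \<omega>[OF t] by (subst xQ) (rule proj_sum)
      also have "\<dots> = (\<Sum>m\<in>M t. proj (\<alpha> (\<sigma> t)) (\<beta> (Max (M t))) (Q m))"
      proof (rule sum.mono_neutral_right)
        show "\<forall>m\<in>{k..l} - M t. proj (\<alpha> (\<sigma> t)) (\<beta> (Max (M t))) (Q m) = 0"
        proof
          fix m assume m: "m \<in> {k..l} - M t"
          have "m < \<sigma> t \<or> Max (M t) < m"
          proof (rule ccontr)
            assume "\<not> ?thesis"
            then have "\<alpha> (\<sigma> t) \<le> \<alpha> m" "\<beta> m \<le> \<beta> (Max (M t))" by (auto intro: mono\<alpha> mono\<beta>)
            then have "m \<in> M t" using m \<sigma>(1,2)[OF t] by (auto simp: M_def)
            with m show False by simp
          qed
          then show "proj (\<alpha> (\<sigma> t)) (\<beta> (Max (M t))) (Q m) = 0"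
            using intervalsD(6)[OF iv, of m "\<sigma> t"] intervalsD(6)[OF iv, of "Max (M t)" m]
            by (intro proj_disjoint[OF Qsup]) blast
        qed
      qed (auto simp: M_def)
      also have "\<dots> = (\<Sum>m\<in>M t. Q m)"
      proof (rule sum.cong[OF refl])
        fix m assume "m \<in> M t"
        then have "\<sigma> t \<le> m" "m \<le> Max (M t)" using finM by (auto simp: \<sigma>_def)
        then show "proj (\<alpha> (\<sigma> t)) (\<beta> (Max (M t))) (Q m) = Q m"
          by (intro proj_id[OF Qsup] mono\<alpha> mono\<beta>)
      qed
      finally show ?thesis by simp
    qed
    have "(\<Sum>t\<in>T. norm (proj (s t) (h t) x)) \<le>
        (\<Sum>t\<in>T. norm (\<Sum>m\<in>M t. Q m) + (\<Sum>m\<in>B1 \<union> B2. norm (proj (s t) (h t) (Q m))))"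
      by (intro sum_mono piece)
    also have "\<dots> \<le> (\<Sum>t\<in>T. norm (\<Sum>m\<in>M t. Q m)) + 2 * (1 / \<delta>) ^ p * \<eta>"
      using err by (simp add: sum.distrib)
    also have "(\<Sum>t\<in>T. norm (\<Sum>m\<in>M t. Q m)) = (\<Sum>t\<in>T'. norm (\<Sum>m\<in>M t. Q m))"
      using finT by (intro sum.mono_neutral_right) (auto simp: T'_def)
    also have "\<dots> = (\<Sum>m\<in>\<sigma> ` T'. norm (proj (\<alpha> m) (\<beta> (\<omega> m)) x))"
      by (simp add: sum.reindex[OF inj] MQ)
    finally show "(\<Sum>t\<in>T. norm (proj (s t) (h t) x)) \<le>
        (\<Sum>m\<in>\<sigma> ` T'. norm (proj (\<alpha> m) (\<beta> (\<omega> m)) x)) + 2 * (1 / \<delta>) ^ p * \<eta>" .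
  qed
qed

end

end

section \<open>Small vectors and distortion\<close>

context bimonotone_biorthogonal
begin

context
  fixes \<delta> :: real and \<xi> :: nat
  assumes asy: "asymptotic_l1 \<delta> \<xi> e" and \<xi>: "1 \<le> \<xi>"
begin

text \<open>Supplies the hypothesis \<open>small\<close> of \<open>admissible_unsplit\<close>.
  Normalizing an average divides by at least \<open>\<delta>\<close>, since its support has order at
  most \<open>\<xi>\<close>, and the coefficients of a combination of the normalized averages are
  bounded by its norm. Smallness of the averages on sets of order \<open>p\<close> thus passes to
  their combinations.\<close>

lemma exists_averaged_sequence:
  assumes iv: "intervals \<alpha> \<beta>" and sup: "\<And>m. supported (\<alpha> m) (\<beta> m) (u m)" and nu: "\<And>m. norm (u m) = 1"
    and p: "Suc p \<le> \<xi>" and \<eta>: "0 < \<eta>"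
  obtains y \<mu> \<nu> where "intervals \<mu> \<nu>" "\<And>k. y k \<in> span (u ` {\<mu> k..\<nu> k})" "\<And>k. norm (y k) = 1"
    "\<And>D B b. finite D \<Longrightarrow> finite B \<Longrightarrow> \<beta> ` B \<in> sch p \<Longrightarrow>
      (\<Sum>m\<in>B. norm (proj (\<alpha> m) (\<beta> m) (\<Sum>k\<in>D. b k *\<^sub>R y k))) \<le> \<eta> * norm (\<Sum>k\<in>D. b k *\<^sub>R y k)"
proof -
  have \<delta>: "0 < \<delta>" by (rule asymptotic_l1_pos[OF asy])
  \<comment> \<open>The factor \<open>\<delta>\<close> cancels the loss in normalizing, and the
    powers of 1/2 add up to at most 1 over the terms of a combination.\<close>
  define eps where "eps k K = \<eta> * \<delta> * (1 / 2) ^ Suc k" for k K :: nat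
  have "\<exists>A a N. N 0 = 0 \<and> mono N \<and>
    (\<forall>k. average \<beta> p (eps k (N k)) (A k) (a k) \<and> A k \<subseteq> {N k..<N (Suc k)})"
    by (rule average_sequence[OF average_exists[OF intervalsD(4)[OF iv]]]) (use \<eta> \<delta> in \<open>simp_all add: eps_def\<close>)
  then obtain A a N where av: "\<And>k. average \<beta> p (eps k (N k)) (A k) (a k)" and sub: "\<And>k. A k \<subseteq> {N k..<N (Suc k)}"
    by metis
  define z where "z k = (\<Sum>m\<in>A k. a k m *\<^sub>R u m)" for k
  define y where "y k = (1 / norm (z k)) *\<^sub>R z k" for k
  have z: "\<delta> \<le> norm (z k)" for k
  proof -
    have "A k \<in> sch \<xi>" using averageD(1)[OF av] sch_mono[OF p] by blast
    from asymptotic_l1_blocks[OF asy iv supported_scaleR[OF sup] this, of "a k"]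
    have "\<delta> * (\<Sum>m\<in>A k. \<bar>a k m\<bar>) \<le> norm (z k)" by (simp add: z_def nu)
    then show ?thesis using averageD(4,6)[OF av[of k]] by simp
  qed
  have z0: "z k \<noteq> 0" for k using z[of k] \<delta> by auto
  then have ny: "norm (y k) = 1" for k by (simp add: y_def)
  define \<nu> where "\<nu> k = N (Suc k) - 1" for k
  have ivN: "intervals N \<nu>"
    unfolding intervals_def \<nu>_def
  proof
    fix k
    obtain m where "m \<in> A k" using averageD(3)[OF av] by blast
    then show "N k \<le> N (Suc k) - 1 \<and> N (Suc k) - 1 < N (Suc k)" using sub[of k] by fastforce
  qed
  have yspan: "y k \<in> span (u ` {N k..\<nu> k})" for k
    unfolding y_def z_def
  proof (intro span_scale span_sum span_base)
    fix m assume "m \<in> A k"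
    then show "u m \<in> u ` {N k..\<nu> k}" using sub[of k] by (fastforce simp: \<nu>_def)
  qed
  show thesis
  proof (rule that[OF ivN yspan ny])
    fix D B :: "nat set" and b :: "nat \<Rightarrow> real"
    assume D: "finite D" and B: "finite B" "\<beta> ` B \<in> sch p"
    define x where "x = (\<Sum>k\<in>D. b k *\<^sub>R y k)"
    have b: "\<bar>b k\<bar> \<le> norm x" if "k \<in> D" for k
      unfolding x_def
      using coeff_abs_le_norm[OF intervals_comp[OF iv ivN] supported_span[OF iv sup yspan] D that ny] .
    have Qy: "norm (proj (\<alpha> m) (\<beta> m) (y k)) \<le> a k m / \<delta>" for m k
    proof -
      have "norm (proj (\<alpha> m) (\<beta> m) (z k)) \<le> a k m"
        unfolding z_def using averageD(2,4)[OF av[of k]] by (simp add: proj_block_sum[OF iv sup] nu)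
      then have "norm (proj (\<alpha> m) (\<beta> m) (y k)) \<le> a k m / norm (z k)"
        by (simp add: y_def proj_scaleR divide_right_mono)
      also have "\<dots> \<le> a k m / \<delta>" using z[of k] z0[of k] \<delta> averageD(4)[OF av[of k]] by (intro divide_left_mono) auto
      finally show ?thesis .
    qed
    have "norm (proj (\<alpha> m) (\<beta> m) x) \<le> (\<Sum>k\<in>D. norm x * (a k m / \<delta>))" for m
      unfolding x_def proj_sum proj_scaleR
    proof (rule sum_norm_le)
      fix k assume "k \<in> D"
      show "norm (b k *\<^sub>R proj (\<alpha> m) (\<beta> m) (y k)) \<le> norm (\<Sum>k\<in>D. b k *\<^sub>R y k) * (a k m / \<delta>)"
        using b[OF \<open>k \<in> D\<close>] Qy[of m k] unfolding x_def norm_scaleR by (intro mult_mono) auto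
    qed
    then have "(\<Sum>m\<in>B. norm (proj (\<alpha> m) (\<beta> m) x)) \<le> (\<Sum>m\<in>B. \<Sum>k\<in>D. norm x * (a k m / \<delta>))"
      by (rule sum_mono)
    also have "\<dots> = (\<Sum>k\<in>D. norm x * (sum (a k) B / \<delta>))"
      by (subst sum.swap) (simp add: sum_distrib_left sum_divide_distrib)
    also have "\<dots> \<le> (\<Sum>k\<in>D. norm x * (\<eta> * (1 / 2) ^ Suc k))"
    proof (rule sum_mono)
      fix k
      have "sum (a k) B \<le> \<eta> * \<delta> * (1 / 2) ^ Suc k" using averageD(7)[OF av B, of k] by (simp add: eps_def)
      then have "sum (a k) B / \<delta> \<le> \<eta> * (1 / 2) ^ Suc k" using \<delta> by (simp add: field_simps)
      then show "norm x * (sum (a k) B / \<delta>) \<le> norm x * (\<eta> * (1 / 2) ^ Suc k)" by (rule mult_left_mono) simp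
    qed
    also have "\<dots> = \<eta> * norm x * (\<Sum>k\<in>D. (1 / 2) ^ Suc k)" by (simp add: sum_distrib_left mult_ac)
    also have "\<dots> \<le> \<eta> * norm x * 1"
      using \<eta> sum_le_suminf[OF sums_summable[OF power_half_series] D] sums_unique[OF power_half_series]
      by (intro mult_left_mono) auto
    finally show "(\<Sum>m\<in>B. norm (proj (\<alpha> m) (\<beta> m) (\<Sum>k\<in>D. b k *\<^sub>R y k))) \<le> \<eta> * norm (\<Sum>k\<in>D. b k *\<^sub>R y k)"
      by (simp add: x_def)
  qed
qed

text \<open>If all vectors of the averaged block subspace had large admissible norm, then decomposing the
  terms of a Schreier combination would express it as a combination of blocks indexed by a set
  of order \<open>p + p\<close>, with a coefficient sum larger than the assumed bound on \<open>l1_index\<close> permits.\<close>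

lemma exists_small_admnorm:
  assumes sp: "sparse_intervals \<alpha> \<beta>" and sup: "\<And>m. supported (\<alpha> m) (\<beta> m) (u m)" and nu: "\<And>m. norm (u m) = 1"
    and p: "p + p \<le> \<xi>" "Suc p \<le> \<xi>" and d: "0 < d"
    and idx: "\<And>w. block_basis e w \<Longrightarrow> l1_index w (d * \<delta>) < enat p"
  shows "\<exists>x\<in>span (range u). x \<noteq> 0 \<and> admnorm p x \<le> (d + 1) * norm x"
proof (rule ccontr)
  assume "\<not> ?thesis"
  then have contra: "(d + 1) * norm x < admnorm p x" if "x \<in> span (range u)" "x \<noteq> 0" for x
    using that by fastforce
  have \<delta>: "0 < \<delta>" by (rule asymptotic_l1_pos[OF asy])
  have iv: "intervals \<alpha> \<beta>" using sp by (simp add: sparse_intervals_def)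
  \<comment> \<open>Makes the error term of \<open>admissible_unsplit\<close> equal to 1, which is
    the 1 in \<open>d + 1\<close>.\<close>
  define \<eta> where "\<eta> = \<delta> ^ p / 2"
  have \<eta>: "0 < \<eta>" "2 * (1 / \<delta>) ^ p * \<eta> = 1" using \<delta> by (simp_all add: \<eta>_def power_divide)
  obtain y \<mu> \<nu> where \<mu>: "intervals \<mu> \<nu>" and y: "\<And>k. y k \<in> span (u ` {\<mu> k..\<nu> k})" "\<And>k. norm (y k) = 1"
    and small: "\<And>D B b. finite D \<Longrightarrow> finite B \<Longrightarrow> \<beta> ` B \<in> sch p \<Longrightarrow>
      (\<Sum>m\<in>B. norm (proj (\<alpha> m) (\<beta> m) (\<Sum>k\<in>D. b k *\<^sub>R y k))) \<le> \<eta> * norm (\<Sum>k\<in>D. b k *\<^sub>R y k)"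
    by (rule exists_averaged_sequence[OF iv sup nu p(2) \<eta>(1)]) (rule that)
  have y0: "y k \<noteq> 0" for k using y(2)[of k] by auto
  have "block_basis e y"
    by (rule block_basisI[OF intervals_comp[OF iv \<mu>] supported_span[OF iv sup y(1)] y0])
  from idx[OF this] d \<delta> obtain v where v: "block_basis y v" "normalized_seq v"
    "\<And>r. strict_mono r \<Longrightarrow> \<exists>F\<in>sch p. \<exists>b. norm (\<Sum>i\<in>F. b i *\<^sub>R v (r i)) < d * \<delta> * (\<Sum>i\<in>F. \<bar>b i\<bar>)"
    using l1_index_less_imp[of y "d * \<delta>" p] by (metis mult_pos_pos)
  have nv: "norm (v i) = 1" for i using v(2) by (simp add: normalized_seq_def)
  obtain \<sigma> \<omega> c where \<sigma>: "intervals \<sigma> \<omega>" and vc: "\<And>i. v i = (\<Sum>k=\<sigma> i..\<omega> i. c i k *\<^sub>R y k)"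
    using block_basisE[OF v(1)] by metis
  define K where "K i = \<mu> (\<sigma> i)" for i
  define L where "L i = \<nu> (\<omega> i)" for i
  have KL: "intervals K L" unfolding K_def L_def by (rule intervals_comp[OF \<mu> \<sigma>])
  have vspan: "v i \<in> span (u ` {K i..L i})" for i
    unfolding vc
  proof (intro span_sum span_scale)
    fix k assume k: "k \<in> {\<sigma> i..\<omega> i}"
    then have "\<mu> (\<sigma> i) \<le> \<mu> k" "\<nu> k \<le> \<nu> (\<omega> i)"
      using strict_mono_mono[OF intervalsD(3)[OF \<mu>]] strict_mono_mono[OF intervalsD(4)[OF \<mu>]]
      by (auto dest: monoD)
    then have "span (u ` {\<mu> k..\<nu> k}) \<subseteq> span (u ` {K i..L i})"
      unfolding K_def L_def by (intro span_mono image_mono) auto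
    then show "y k \<in> span (u ` {K i..L i})" using y(1)[of k] by blast
  qed
  have vspan': "v i \<in> span (range u)" for i
    using vspan[of i] span_mono[of "u ` {K i..L i}" "range u"] by blast
  have vsup: "supported (\<alpha> (K i)) (\<beta> (L i)) (v i)" for i by (rule supported_span[OF iv sup vspan])
  define R where "R i S W \<longleftrightarrow> S \<subseteq> {K i..L i} \<and> (\<lambda>m. \<alpha> m div 2) ` S \<in> sch p \<and>
      (\<forall>\<sigma>\<in>S. \<sigma> \<le> W \<sigma> \<and> W \<sigma> \<le> L i) \<and> (\<forall>\<sigma>\<in>S. \<forall>\<tau>\<in>S. \<sigma> < \<tau> \<longrightarrow> W \<sigma> < \<tau>) \<and>
      d \<le> (\<Sum>\<sigma>\<in>S. norm (proj (\<alpha> \<sigma>) (\<beta> (W \<sigma>)) (v i)))" for i S W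
  have "\<exists>S W. R i S W" for i
  proof -
    have "v i \<noteq> 0" using nv[of i] by auto
    from contra[OF vspan' this] have "d + 1 < admnorm p (v i)" by (simp add: nv)
    then obtain T s h where T: "admissible p T s h" "d + 1 < (\<Sum>t\<in>T. norm (proj (s t) (h t) (v i)))"
      using admnorm_least[OF asy \<xi>, of p "v i" "d + 1"] by (meson not_le)
    have sm: "(\<Sum>m\<in>B. norm (proj (\<alpha> m) (\<beta> m) (v i))) \<le> \<eta>" if "finite B" "\<beta> ` B \<in> sch p" for B
      using small[of "{\<sigma> i..\<omega> i}" B "c i"] that nv[of i] unfolding vc[symmetric] by simp
    obtain S W where S: "S \<subseteq> {K i..L i}" "(\<lambda>m. \<alpha> m div 2) ` S \<in> sch p"
      "\<And>\<sigma>. \<sigma> \<in> S \<Longrightarrow> \<sigma> \<le> W \<sigma> \<and> W \<sigma> \<le> L i" "\<And>\<sigma> \<tau>. \<sigma> \<in> S \<Longrightarrow> \<tau> \<in> S \<Longrightarrow> \<sigma> < \<tau> \<Longrightarrow> W \<sigma> < \<tau>"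
      "(\<Sum>t\<in>T. norm (proj (s t) (h t) (v i))) \<le>
         (\<Sum>\<sigma>\<in>S. norm (proj (\<alpha> \<sigma>) (\<beta> (W \<sigma>)) (v i))) + 2 * (1 / \<delta>) ^ p * \<eta>"
      by (rule admissible_unsplit[OF asy \<xi> sp span_block_expansion[OF iv sup vspan] _ T(1)],
          erule (1) sm, rule that)
    have "d \<le> (\<Sum>\<sigma>\<in>S. norm (proj (\<alpha> \<sigma>) (\<beta> (W \<sigma>)) (v i)))" using S(5) T(2) \<eta>(2) by simp
    then show ?thesis using S(1-4) unfolding R_def by blast
  qed
  then obtain S W where RSW: "\<And>i. R i (S i) (W i)" by metis
  have S: "\<And>i. S i \<subseteq> {K i..L i}" "\<And>i. (\<lambda>m. \<alpha> m div 2) ` S i \<in> sch p"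
      "\<And>i \<sigma>. \<sigma> \<in> S i \<Longrightarrow> \<sigma> \<le> W i \<sigma> \<and> W i \<sigma> \<le> L i"
      "\<And>i \<sigma> \<tau>. \<sigma> \<in> S i \<Longrightarrow> \<tau> \<in> S i \<Longrightarrow> \<sigma> < \<tau> \<Longrightarrow> W i \<sigma> < \<tau>"
      "\<And>i. d \<le> (\<Sum>\<sigma>\<in>S i. norm (proj (\<alpha> \<sigma>) (\<beta> (W i \<sigma>)) (v i)))"
    using RSW unfolding R_def by blast+
  have idm: "strict_mono (\<lambda>i::nat. i)" by (simp add: strict_mono_def)
  obtain F b where F: "F \<in> sch p" and b: "norm (\<Sum>i\<in>F. b i *\<^sub>R v i) < d * \<delta> * (\<Sum>i\<in>F. \<bar>b i\<bar>)"
    using v(3)[OF idm] by blast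
  have finF: "finite F" by (rule finite_sch[OF F])
  define x where "x = (\<Sum>i\<in>F. b i *\<^sub>R v i)"
  define SS where "SS = (\<Union>i\<in>F. S i)"
  \<comment> \<open>The sets \<open>S i\<close> lie in the disjoint ranges from \<open>K i\<close>
    to \<open>L i\<close>, so the first range reaching \<open>m\<close> identifies \<open>i\<close>.
    This merges the functions \<open>W i\<close> into one.\<close>
  define idx where "idx m = (LEAST i. m \<le> L i)" for m
  define \<Omega> where "\<Omega> m = W (idx m) m" for m
  have idx: "idx m = i" if "m \<in> S i" for i m
    unfolding idx_def
  proof (rule Least_equality)
    show "m \<le> L i" using S(1) that by fastforce
    show "i \<le> k" if "m \<le> L k" for k
    proof (rule ccontr)
      assume "\<not> i \<le> k"
      then have "L k < K i" using intervalsD(6)[OF KL, of k i] by simp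
      then show False using that S(1)[of i] \<open>m \<in> S i\<close> by fastforce
    qed
  qed
  have \<Omega>: "\<Omega> m = W i m" if "m \<in> S i" for i m using idx[OF that] by (simp add: \<Omega>_def)
  have SL: "K i \<le> m" "m \<le> L i" if "m \<in> S i" for i m using S(1) that by fastforce+
  have "\<delta> * (\<Sum>\<sigma>\<in>SS. norm (proj (\<alpha> \<sigma>) (\<beta> (\<Omega> \<sigma>)) x)) \<le> norm x"
  proof (rule sparse_lower_bound[OF asy \<xi> sp])
    \<comment> \<open>The composition of two families of order \<open>p\<close>: for
      \<open>m\<close> in \<open>S i\<close> the outer index satisfies
      \<open>i \<le> K i \<le> m \<le> \<alpha> m div 2\<close>.\<close>
    have "(\<Union>i\<in>F. (\<lambda>m. \<alpha> m div 2) ` S i) \<in> sch (p + p)"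
    proof (rule sch_Union[OF F S(2)])
      fix i m assume "m \<in> (\<lambda>m. \<alpha> m div 2) ` S i"
      then obtain m' where m': "m' \<in> S i" "m = \<alpha> m' div 2" by blast
      have "i \<le> K i" by (rule intervalsD(5)[OF KL])
      also have "\<dots> \<le> m'" by (rule SL[OF m'(1)])
      also have "\<dots> \<le> m" unfolding m'(2) by (rule sparse_intervals_half(2)[OF sp])
      finally show "i \<le> m" .
    next
      fix i k m n assume ik: "i < k" and "m \<in> (\<lambda>m. \<alpha> m div 2) ` S i" "n \<in> (\<lambda>m. \<alpha> m div 2) ` S k"
      then obtain m' n' where m': "m' \<in> S i" "m = \<alpha> m' div 2" "n' \<in> S k" "n = \<alpha> n' div 2" by blast
      then have "m' < n'" using SL(2)[OF m'(1)] SL(1)[OF m'(3)] intervalsD(6)[OF KL ik] by linarith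
      then show "m < n" unfolding m' by (rule strict_monoD[OF sparse_intervals_half(1)[OF sp]])
    qed
    then show "(\<lambda>m. \<alpha> m div 2) ` SS \<in> sch \<xi>"
      using sch_mono[OF p(1)] by (auto simp: SS_def image_UN)
    show "m \<le> \<Omega> m" if "m \<in> SS" for m using that S(3) \<Omega> by (auto simp: SS_def)
    show "\<Omega> m < n" if "m \<in> SS" "n \<in> SS" "m < n" for m n
    proof -
      from that obtain i k where i: "m \<in> S i" "n \<in> S k" by (auto simp: SS_def)
      show ?thesis
      proof (cases i k rule: linorder_cases)
        case less
        then show ?thesis
          using S(3)[OF i(1)] \<Omega>[OF i(1)] SL(1)[OF i(2)] intervalsD(6)[OF KL less] by linarith
      next
        case equal
        then show ?thesis using S(4)[OF i(1), of n] i that(3) \<Omega>[OF i(1)] by simp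
      next
        case greater
        then show ?thesis
          using SL(1)[OF i(1)] SL(2)[OF i(2)] intervalsD(6)[OF KL greater] that(3) by linarith
      qed
    qed
    have "x \<in> span (range u)" unfolding x_def by (intro span_sum span_scale vspan')
    then show "\<exists>m. \<alpha> m \<le> i \<and> i \<le> \<beta> m" if "blinfun_apply (f i) x \<noteq> 0" for i
      using that by (rule span_block_gaps[OF sup])
  qed
  moreover have "d * (\<Sum>i\<in>F. \<bar>b i\<bar>) \<le> (\<Sum>\<sigma>\<in>SS. norm (proj (\<alpha> \<sigma>) (\<beta> (\<Omega> \<sigma>)) x))"
  proof -
    \<comment> \<open>A piece named by an element of \<open>S i\<close> stays within the range of
      \<open>v i\<close> and sees no other term of \<open>x\<close>. The bound \<open>d\<close> for
      every \<open>v i\<close> therefore yields \<open>d\<close> times the coefficient sum.\<close>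
    have px: "proj (\<alpha> \<sigma>) (\<beta> (\<Omega> \<sigma>)) x = b i *\<^sub>R proj (\<alpha> \<sigma>) (\<beta> (W i \<sigma>)) (v i)" if i: "i \<in> F" "\<sigma> \<in> S i" for i \<sigma>
    proof -
      have "proj (\<alpha> \<sigma>) (\<beta> (W i \<sigma>)) (v k) = 0" if k: "k \<noteq> i" for k
      proof (rule proj_disjoint[OF vsup])
        have mono: "\<alpha> (K i) \<le> \<alpha> \<sigma>" "\<beta> (W i \<sigma>) \<le> \<beta> (L i)"
          using strict_mono_mono[OF intervalsD(3)[OF iv]] strict_mono_mono[OF intervalsD(4)[OF iv]]
            SL(1)[OF i(2)] S(3)[OF i(2)] by (auto dest: monoD)
        show "\<beta> (W i \<sigma>) < \<alpha> (K k) \<or> \<beta> (L k) < \<alpha> \<sigma>"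
          using k mono intervalsD(6)[OF intervals_comp[OF iv KL], of i k]
            intervalsD(6)[OF intervals_comp[OF iv KL], of k i]
          by (cases i k rule: linorder_cases) auto
      qed
      then have "proj (\<alpha> \<sigma>) (\<beta> (W i \<sigma>)) x = (\<Sum>k\<in>F. if k = i then b i *\<^sub>R proj (\<alpha> \<sigma>) (\<beta> (W i \<sigma>)) (v i) else 0)"
        unfolding x_def proj_sum proj_scaleR by (intro sum.cong refl) auto
      then show ?thesis using finF i(1) by (simp add: \<Omega>[OF i(2)])
    qed
    have "(\<Sum>\<sigma>\<in>SS. norm (proj (\<alpha> \<sigma>) (\<beta> (\<Omega> \<sigma>)) x)) = (\<Sum>i\<in>F. \<Sum>\<sigma>\<in>S i. norm (proj (\<alpha> \<sigma>) (\<beta> (\<Omega> \<sigma>)) x))"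
      unfolding SS_def
    proof (rule sum.UNION_disjoint[OF finF])
      show "\<forall>i\<in>F. finite (S i)" using S(1) finite_subset by blast
      show "\<forall>i\<in>F. \<forall>k\<in>F. i \<noteq> k \<longrightarrow> S i \<inter> S k = {}" using idx by blast
    qed
    also have "\<dots> = (\<Sum>i\<in>F. \<bar>b i\<bar> * (\<Sum>\<sigma>\<in>S i. norm (proj (\<alpha> \<sigma>) (\<beta> (W i \<sigma>)) (v i))))"
      by (intro sum.cong refl) (simp add: px sum_distrib_left)
    also have "\<dots> \<ge> (\<Sum>i\<in>F. \<bar>b i\<bar> * d)" by (intro sum_mono mult_left_mono S(5)) simp
    finally show ?thesis by (simp add: sum_distrib_left mult.commute)
  qed
  ultimately have "\<delta> * (d * (\<Sum>i\<in>F. \<bar>b i\<bar>)) \<le> norm x"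
    using mult_left_mono[of _ _ \<delta>] \<delta> by (meson less_imp_le order.trans)
  then show False using b by (simp add: x_def mult_ac)
qed

end

section \<open>Approximating vectors of arbitrary subspaces by blocks\<close>

lemma infinite_dim_tail:
  assumes Y: "subspace Y" and inf: "\<not> (\<exists>B. finite B \<and> Y \<subseteq> span B)"
  shows "\<not> (\<exists>B. finite B \<and> {z \<in> Y. \<forall>i<N. blinfun_apply (f i) z = 0} \<subseteq> span B)"
proof (induction N)
  case 0
  then show ?case using inf by simp
next
  case (Suc N)
  let ?Z = "\<lambda>N. {z \<in> Y. \<forall>i<N. blinfun_apply (f i) z = 0}"
  show ?case
  proof
    assume "\<exists>B. finite B \<and> ?Z (Suc N) \<subseteq> span B"
    then obtain B where B: "finite B" "?Z (Suc N) \<subseteq> span B" by (elim exE conjE)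
    have "\<exists>B'. finite B' \<and> ?Z N \<subseteq> span B'"
    proof (cases "\<exists>w\<in>?Z N. blinfun_apply (f N) w \<noteq> 0")
      case False
      then have "?Z N \<subseteq> ?Z (Suc N)" by (auto simp: less_Suc_eq)
      then have "?Z N \<subseteq> span B" using B(2) by (rule order_trans)
      with B(1) show ?thesis by (intro exI[of _ B] conjI)
    next
      case True
      then obtain w where w: "w \<in> ?Z N" "blinfun_apply (f N) w \<noteq> 0" by blast
      have "z \<in> span (insert w B)" if z: "z \<in> ?Z N" for z
      proof -
        \<comment> \<open>One further vanishing coordinate lowers the dimension by at most one:
          subtracting a multiple of \<open>w\<close> enforces it.\<close>
        define c where "c = blinfun_apply (f N) z / blinfun_apply (f N) w"
        have "z - c *\<^sub>R w \<in> ?Z (Suc N)"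
          using z w Y by (auto simp: c_def less_Suc_eq blinfun.diff_right blinfun.scaleR_right subspace_diff subspace_scale)
        then have "z - c *\<^sub>R w \<in> span B" using B(2) by blast
        then show ?thesis by (auto simp: span_insert)
      qed
      then show ?thesis using B(1) by (intro exI[of _ "insert w B"] conjI subsetI) auto
    qed
    with Suc.IH show False by (rule notE)
  qed
qed

text \<open>One step of a gliding hump: some nonzero vector of \<open>Y\<close> vanishes before
  \<open>N\<close>, and cutting it off far out leaves a block. The scaling makes the block, rather
  than the vector of \<open>Y\<close>, have norm 1.\<close>

lemma near_block_vector:
  assumes Y: "subspace Y" and inf: "\<not> (\<exists>B. finite B \<and> Y \<subseteq> span B)" and \<eta>: "0 < \<eta>"
  shows "\<exists>z\<in>Y. \<exists>M\<ge>N. norm (proj N M z) = 1 \<and> norm (z - proj N M z) \<le> \<eta>"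
proof -
  have "\<not> {z \<in> Y. \<forall>i<N. blinfun_apply (f i) z = 0} \<subseteq> span {}"
    using infinite_dim_tail[OF Y inf, of N] by blast
  then obtain z where z: "z \<in> Y" "\<And>i. i < N \<Longrightarrow> blinfun_apply (f i) z = 0" "z \<noteq> 0" by auto
  \<comment> \<open>The 1/2 keeps the norm of the block above \<open>norm z / 2\<close>; then
    \<open>\<eta> / 2\<close> gives an error of at most \<open>\<eta>\<close> relative to the
    block.\<close>
  define \<epsilon> where "\<epsilon> = min (1 / 2) (\<eta> / 2) * norm z"
  have "0 < \<epsilon>" using z(3) \<eta> by (simp add: \<epsilon>_def)
  then obtain M where M: "norm (proj 0 M z - z) < \<epsilon>"
    using proj_tendsto[of z] by (auto simp: LIMSEQ_iff)
  define w where "w = proj N M z"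
  have "proj 0 M z = w" unfolding w_def by (rule coeff_eqI) (use z(2) in \<open>auto simp: coeff_proj not_le\<close>)
  with M have M': "norm (z - w) < \<epsilon>" by (simp add: norm_minus_commute)
  have half: "norm z / 2 < norm w"
  proof -
    have "\<epsilon> \<le> 1 / 2 * norm z" unfolding \<epsilon>_def by (rule mult_right_mono) auto
    then show ?thesis using M' norm_triangle_sub[of z w] by linarith
  qed
  then have w0: "0 < norm w" by (meson norm_ge_zero divide_nonneg_pos order_le_less_trans zero_less_numeral)
  have "\<epsilon> \<le> \<eta> * norm w"
  proof -
    have "\<epsilon> \<le> \<eta> / 2 * norm z" unfolding \<epsilon>_def by (rule mult_right_mono) auto
    also have "\<dots> = \<eta> * (norm z / 2)" by simp
    also have "\<dots> \<le> \<eta> * norm w" using half \<eta> by (intro mult_left_mono) auto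
    finally show ?thesis .
  qed
  then have "norm (z - w) / norm w \<le> \<eta>" using M' w0 by (simp add: field_simps)
  moreover have "N \<le> M" using w0 proj_empty[of M N z] unfolding w_def by (cases "M < N") auto
  moreover have "(1 / norm w) *\<^sub>R z \<in> Y" by (rule subspace_scale[OF Y z(1)])
  moreover have "norm ((1 / norm w) *\<^sub>R z - (1 / norm w) *\<^sub>R w) = norm (z - w) / norm w"
    by (simp flip: scaleR_diff_right)
  ultimately show ?thesis using w0
    by (intro bexI[of _ "(1 / norm w) *\<^sub>R z"] exI[of _ M]) (simp_all add: proj_scaleR flip: w_def)
qed

text \<open>The errors of the single blocks form a geometric series with sum \<open>\<eta>\<close>,
  and bimonotonicity bounds the coefficients of a combination by its norm. Replacing each block by
  its neighbour in \<open>Y\<close> therefore costs at most \<open>\<eta>\<close> times that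
  norm.\<close>

lemma near_block_sequence:
  assumes Y: "subspace Y" and inf: "\<not> (\<exists>B. finite B \<and> Y \<subseteq> span B)" and \<eta>: "0 < \<eta>"
  obtains \<alpha> \<beta> u where "sparse_intervals \<alpha> \<beta>" "\<And>m. supported (\<alpha> m) (\<beta> m) (u m)" "\<And>m. norm (u m) = 1"
    "\<And>x. x \<in> span (range u) \<Longrightarrow> \<exists>y\<in>Y. norm (x - y) \<le> \<eta> * norm x"
proof -
  define P where "P k s = (case s of (z, a, b) \<Rightarrow> z \<in> Y \<and> 2 * k < a \<and> a \<le> b \<and> norm (proj a b z) = 1 \<and>
    norm (z - proj a b z) \<le> \<eta> * (1 / 2) ^ Suc k)" for k :: nat and s :: "'a \<times> nat \<times> nat"
  have ex: "\<exists>z b. P k (z, a, b)" if "2 * k < a" for k a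
    using near_block_vector[OF Y inf, of "\<eta> * (1 / 2) ^ Suc k" a] \<eta> that by (auto simp: P_def)
  have "\<exists>g. \<forall>k. P k (g k) \<and> 2 * snd (snd (g k)) < fst (snd (g (Suc k)))"
  proof (rule dependent_nat_choice)
    show "\<exists>s. P 0 s" using ex[of 0 1] by auto
    show "\<exists>s'. P (Suc k) s' \<and> 2 * snd (snd s) < fst (snd s')" for s k
      using ex[of "Suc k" "2 * snd (snd s) + 2 * Suc k + 1"] by fastforce
  qed
  then obtain g where g: "\<And>k. P k (g k)" "\<And>k. 2 * snd (snd (g k)) < fst (snd (g (Suc k)))" by blast
  define z where "z k = fst (g k)" for k
  define \<alpha> where "\<alpha> k = fst (snd (g k))" for k
  define \<beta> where "\<beta> k = snd (snd (g k))" for k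
  define u where "u k = proj (\<alpha> k) (\<beta> k) (z k)" for k
  have z: "z k \<in> Y" "2 * k < \<alpha> k" "\<alpha> k \<le> \<beta> k" "norm (u k) = 1" "norm (z k - u k) \<le> \<eta> * (1 / 2) ^ Suc k" for k
    using g(1)[of k] by (auto simp: P_def z_def \<alpha>_def \<beta>_def u_def split: prod.splits)
  have gap: "2 * \<beta> k < \<alpha> (Suc k)" for k using g(2)[of k] by (simp add: \<alpha>_def \<beta>_def)
  have "\<beta> k < \<alpha> (Suc k)" for k using gap[of k] by simp
  then have iv: "intervals \<alpha> \<beta>" using z(3) by (simp add: intervals_def)
  have sup: "supported (\<alpha> m) (\<beta> m) (u m)" for m unfolding u_def by (rule supported_proj)
  show thesis
  proof (rule that[OF _ sup z(4)])
    show "sparse_intervals \<alpha> \<beta>" using iv z(2) gap by (simp add: sparse_intervals_def)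
    fix x assume "x \<in> span (range u)"
    then obtain D a where D: "finite D" and x: "x = (\<Sum>m\<in>D. a m *\<^sub>R u m)" by (rule span_range_sumE)
    define y where "y = (\<Sum>m\<in>D. a m *\<^sub>R z m)"
    have "x - y = (\<Sum>m\<in>D. a m *\<^sub>R (u m - z m))"
      by (simp add: x y_def scaleR_diff_right sum_subtractf)
    then have "norm (x - y) \<le> (\<Sum>m\<in>D. norm x * (\<eta> * (1 / 2) ^ Suc m))"
    proof (simp only:, intro sum_norm_le)
      fix m assume "m \<in> D"
      then have "\<bar>a m\<bar> \<le> norm x" unfolding x using coeff_abs_le_norm[OF iv sup D _ z(4)] by blast
      then show "norm (a m *\<^sub>R (u m - z m)) \<le> norm x * (\<eta> * (1 / 2) ^ Suc m)"
        using z(5)[of m] unfolding norm_scaleR norm_minus_commute[of "u m"] by (intro mult_mono) auto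
    qed
    also have "\<dots> = \<eta> * norm x * (\<Sum>m\<in>D. (1 / 2) ^ Suc m)" by (simp add: sum_distrib_left mult_ac)
    also have "\<dots> \<le> \<eta> * norm x * 1"
      using \<eta> sum_le_suminf[OF sums_summable[OF power_half_series] D] sums_unique[OF power_half_series]
      by (intro mult_left_mono) auto
    finally have "norm (x - y) \<le> \<eta> * norm x" by simp
    moreover have "y \<in> Y" unfolding y_def by (intro subspace_sum subspace_scale Y z(1))
    ultimately show "\<exists>y\<in>Y. norm (x - y) \<le> \<eta> * norm x" by blast
  qed
qed

text \<open>Two block vectors are replaced by nearby vectors of \<open>Y\<close>, each at the cost
  of a factor 2, hence the 4. In \<open>d + 3\<close>, the part \<open>d + 1\<close> bounds the
  admissible norm of the small vector, and the rest covers the added original norm and the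
  perturbation.\<close>

lemma admnorm_distorts:
  assumes asy: "asymptotic_l1 \<delta> \<xi> e" and p: "1 \<le> p" "p + p \<le> \<xi>" and d: "0 < d"
    and idx: "\<And>w. block_basis e w \<Longrightarrow> l1_index w (d * \<delta>) < enat p"
    and Y: "subspace Y" and inf: "\<not> (\<exists>B. finite B \<and> Y \<subseteq> span B)"
    and l: "4 * d * \<delta> * (d + 3) * l < 1" "0 < l"
  shows "\<exists>x\<in>Y. \<exists>y\<in>Y. x \<noteq> 0 \<and> y \<noteq> 0 \<and> norm x = norm y \<and>
    l < (norm x + admnorm p x) / (norm y + admnorm p y)"
proof -
  have \<delta>: "0 < \<delta>" by (rule asymptotic_l1_pos[OF asy])
  have \<xi>: "1 \<le> \<xi>" "Suc p \<le> \<xi>" using p by auto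
  define q where "q x = norm x + admnorm p x" for x
  define C where "C = 1 + (1 / \<delta>) ^ p"
  have C: "1 < C" using \<delta> by (simp add: C_def)
  have q_le: "q x \<le> C * norm x" for x
    using admnorm_le[OF asy \<xi>(1), of p x] by (simp add: q_def C_def distrib_right)
  have norm_q: "norm x \<le> q x" for x using admnorm_nonneg[OF asy \<xi>(1)] by (simp add: q_def)
  have q_tri: "q (x + y) \<le> q x + q y" for x y
    using norm_triangle_ineq[of x y] admnorm_triangle[OF asy \<xi>(1), of p x y] by (simp add: q_def)
  have q_scale: "q (c *\<^sub>R x) = \<bar>c\<bar> * q x" for c x
    by (simp add: q_def admnorm_scaleR[OF asy \<xi>(1)] distrib_left)
  \<comment> \<open>A relative error \<open>\<eta>\<close> in the original norm becomes at most 1/2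
    when measured by \<open>q\<close>.\<close>
  define \<eta> where "\<eta> = 1 / (2 * C)"
  have \<eta>: "0 < \<eta>" "\<eta> \<le> 1 / 2" "C * \<eta> = 1 / 2" using C by (simp_all add: \<eta>_def field_simps)
  obtain \<alpha> \<beta> u where sp: "sparse_intervals \<alpha> \<beta>" and sup: "\<And>m. supported (\<alpha> m) (\<beta> m) (u m)"
    and nu: "\<And>m. norm (u m) = 1"
    and near: "\<And>x. x \<in> span (range u) \<Longrightarrow> \<exists>y\<in>Y. norm (x - y) \<le> \<eta> * norm x"
    by (rule near_block_sequence[OF Y inf \<eta>(1)]) (rule that)
  have iv: "intervals \<alpha> \<beta>" using sp by (simp add: sparse_intervals_def)
  have near': "\<exists>y\<in>Y. norm (x - y) \<le> norm x / 2 \<and> q (x - y) \<le> norm x / 2 \<and> q (y - x) \<le> norm x / 2"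
    if "x \<in> span (range u)" for x
  proof -
    from near[OF that] obtain y where y: "y \<in> Y" "norm (x - y) \<le> \<eta> * norm x" by blast
    have "\<eta> * norm x \<le> 1 / 2 * norm x" using \<eta>(2) by (rule mult_right_mono) simp
    moreover have "C * norm (x - y) \<le> C * (\<eta> * norm x)" using y(2) C by (intro mult_left_mono) auto
    then have "C * norm (x - y) \<le> norm x / 2" using \<eta>(3) by (metis mult.assoc mult.commute times_divide_eq_right mult_1_right)
    ultimately show ?thesis
      using y q_le[of "x - y"] q_le[of "y - x"] by (intro bexI[of _ y]) (auto simp: norm_minus_commute)
  qed
  have u0: "u m \<noteq> 0" for m using nu[of m] by auto
  have "block_basis e u" by (rule block_basisI[OF iv sup u0])
  from idx[OF this] obtain x' where x': "x' \<in> span (range u)" "x' \<noteq> 0" "norm x' \<le> d * \<delta> * admnorm p x'"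
    using exists_large_admnorm[OF asy \<xi>(1) iv sup, of "d * \<delta>" p] d \<delta> by auto
  obtain y' where y': "y' \<in> span (range u)" "y' \<noteq> 0" "admnorm p y' \<le> (d + 1) * norm y'"
    using exists_small_admnorm[OF asy \<xi>(1) sp sup nu p(2) \<xi>(2) d idx] by blast
  obtain x where x: "x \<in> Y" "norm (x' - x) \<le> norm x' / 2" "q (x' - x) \<le> norm x' / 2" using near'[OF x'(1)] by blast
  obtain y where y: "y \<in> Y" "norm (y' - y) \<le> norm y' / 2" "q (y - y') \<le> norm y' / 2" using near'[OF y'(1)] by blast
  have nx: "norm x \<le> 2 * norm x'" "0 < norm x"
  proof -
    have "0 < norm x'" using x'(2) by simp
    then show "norm x \<le> 2 * norm x'" "0 < norm x"
      using norm_triangle_sub[of x x'] norm_triangle_sub[of x' x] x(2) norm_minus_commute[of x x'] by linarith+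
  qed
  have ny: "norm y' \<le> 2 * norm y" "0 < norm y"
  proof -
    have "0 < norm y'" using y'(2) by simp
    then show "norm y' \<le> 2 * norm y" "0 < norm y"
      using norm_triangle_sub[of y' y] y(2) by linarith+
  qed
  have qx: "norm x \<le> 2 * (d * \<delta>) * q x"
  proof -
    have "q x' \<le> q x + norm x' / 2" using q_tri[of x "x' - x"] x(3) by simp
    then have "admnorm p x' \<le> q x" using norm_ge_zero[of x'] unfolding q_def[of x'] by linarith
    then have "d * \<delta> * admnorm p x' \<le> d * \<delta> * q x" using d \<delta> by (intro mult_left_mono) auto
    then show ?thesis using x'(3) nx(1) by linarith
  qed
  have qy: "q y \<le> 2 * (d + 3) * norm y"
  proof -
    have "q y \<le> q y' + norm y' / 2" using q_tri[of y' "y - y'"] y(3) by simp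
    also have "\<dots> \<le> norm y' + (d + 1) * norm y' + norm y'"
      using y'(3) norm_ge_zero[of y'] unfolding q_def[of y'] by linarith
    also have "\<dots> = (d + 3) * norm y'" by (simp add: algebra_simps)
    also have "\<dots> \<le> (d + 3) * (2 * norm y)" using ny(1) d by (intro mult_left_mono) auto
    finally show ?thesis by (simp add: mult_ac)
  qed
  define w where "w = (norm x / norm y) *\<^sub>R y"
  have nw: "norm w = norm x" using ny(2) by (simp add: w_def)
  have qw: "q w \<le> 2 * (d + 3) * norm x"
  proof -
    have "q w = norm x / norm y * q y" using ny(2) by (simp add: w_def q_scale)
    also have "\<dots> \<le> norm x / norm y * (2 * (d + 3) * norm y)" using qy by (intro mult_left_mono) auto
    also have "\<dots> = 2 * (d + 3) * norm x" using ny(2) by simp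
    finally show ?thesis .
  qed
  have qx0: "0 < q x" and qw0: "0 < q w" using norm_q[of x] norm_q[of w] nw nx(2) by linarith+
  have "l * q w \<le> l * (2 * (d + 3) * norm x)" using qw l(2) by (intro mult_left_mono) auto
  also have "\<dots> \<le> l * (2 * (d + 3) * (2 * (d * \<delta>) * q x))" using qx l(2) d by (intro mult_left_mono) auto
  also have "\<dots> = (4 * d * \<delta> * (d + 3) * l) * q x" by (simp add: algebra_simps)
  also have "\<dots> < 1 * q x" using l(1) qx0 by (rule mult_strict_right_mono)
  finally have "l < q x / q w" using qw0 by (simp add: field_simps)
  moreover have "w \<in> Y" unfolding w_def by (rule subspace_scale[OF Y y(1)])
  moreover have "x \<noteq> 0" "w \<noteq> 0" using nx(2) nw by auto
  ultimately show ?thesis using x(1) nw unfolding q_def by (intro bexI[of _ x] bexI[of _ w]) auto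
qed

end

theorem theorem3p2:
  fixes e :: "nat \<Rightarrow> 'a::banach"
  assumes "schauder_basis e" and "normalized_seq e"
    and "shrinking_basis e" and "bimonotone_basis e"
    and "\<exists>(N :: nat set) (P :: nat set) (\<delta> :: nat \<Rightarrow> real) (d :: real).
           distortion_property e d N P \<delta>"
  shows "arbitrarily_distortable TYPE('a)"
proof -
  from assms(3) obtain f :: "nat \<Rightarrow> ('a \<Rightarrow>\<^sub>L real)"
    where f: "\<And>m n. blinfun_apply (f m) (e n) = (if m = n then 1 else 0)"
    unfolding shrinking_basis_def by blast
  have expansion: "(\<lambda>n. blinfun_apply (f n) x *\<^sub>R e n) sums x" for x
  proof -
    from assms(1) obtain a :: "nat \<Rightarrow> real" where a: "(\<lambda>n. a n *\<^sub>R e n) sums x"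
      unfolding schauder_basis_def by blast
    have "blinfun_apply (f m) x = a m" for m
    proof -
      have "(\<lambda>n. blinfun_apply (f m) (a n *\<^sub>R e n)) sums blinfun_apply (f m) x"
        by (rule bounded_linear.sums[OF blinfun.bounded_linear_right a])
      moreover have "blinfun_apply (f m) (a n *\<^sub>R e n) = (if n = m then a n else 0)" for n
        by (simp add: blinfun.scaleR_right f)
      ultimately have "(\<lambda>n. if n = m then a n else 0) sums blinfun_apply (f m) x" by simp
      then show ?thesis using sums_single[of m a] by (rule sums_unique2)
    qed
    with a show ?thesis by simp
  qed
  interpret bimonotone_biorthogonal e f
  proof
    show "norm (\<Sum>i=m..n. blinfun_apply (f i) x *\<^sub>R e i) \<le> norm x" for m n x
      using assms(4) expansion[of x] unfolding bimonotone_basis_def by fastforce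
  qed (use assms(2) f expansion in \<open>auto simp: normalized_seq_def\<close>)
  from assms(5) obtain N P \<delta> d where dp: "distortion_property e d N P \<delta>" by blast
  have null: "\<delta> \<longlonglongrightarrow> 0" and d: "1 < d" and P0: "0 \<notin> P" "infinite P"
    and half: "real (enumerate P j) < real (enumerate N j) / 2"
    and asy: "asymptotic_l1 (\<delta> j) (enumerate N j) e"
    and idx: "block_basis e u \<Longrightarrow> l1_index u (d * \<delta> j) < enat (enumerate P j)" for j u
    using dp unfolding distortion_property_def by auto
  show ?thesis
    unfolding arbitrarily_distortable_def
  proof (intro allI impI)
    fix l :: real assume l: "1 < l"
    \<comment> \<open>For \<open>\<delta> j < 1 / c\<close> the ratio given by
      \<open>admnorm_distorts\<close> exceeds \<open>l\<close>.\<close>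
    define c where "c = 4 * d * (d + 3) * l"
    have c: "0 < c" using d l by (simp add: c_def)
    have "0 < 1 / c" using c by simp
    with null have "eventually (\<lambda>j. \<delta> j < 1 / c) sequentially" by (rule order_tendstoD)
    then obtain j where "\<delta> j < 1 / c" by (metis eventually_sequentially order.refl)
    then have "c * \<delta> j < 1" using c by (simp add: field_simps)
    then have small: "4 * d * \<delta> j * (d + 3) * l < 1" by (simp add: c_def mult_ac)
    define p where "p = enumerate P j"
    have "p \<in> P" unfolding p_def by (rule enumerate_in_set[OF P0(2)])
    \<comment> \<open>With \<open>p \<ge> 1\<close>, \<open>p + p\<close> is at least
      \<open>Suc p\<close>, so the order of the averages is covered as well.\<close>
    with P0(1) have p1: "1 \<le> p" by (cases p) auto
    have p2: "p + p \<le> enumerate N j" using half[of j] unfolding p_def by linarith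
    have "equivalent_norm (\<lambda>x. norm x + admnorm p x)"
      by (rule equivalent_norm_admnorm[OF asy[of j]]) (use p1 p2 in linarith)
    moreover have "\<exists>x\<in>Y. \<exists>y\<in>Y. x \<noteq> 0 \<and> y \<noteq> 0 \<and> norm x = norm y \<and>
        l < (norm x + admnorm p x) / (norm y + admnorm p y)"
      if "infinite_dim_closed_subspace Y" for Y
      using that d l small idx unfolding infinite_dim_closed_subspace_def p_def[symmetric]
      by (intro admnorm_distorts[OF asy[of j] p1 p2, where d = d]) (auto simp: p_def)
    ultimately show "\<exists>q :: 'a \<Rightarrow> real. equivalent_norm q \<and>
        (\<forall>Y. infinite_dim_closed_subspace Y \<longrightarrow>
           (\<exists>x\<in>Y. \<exists>y\<in>Y. x \<noteq> 0 \<and> y \<noteq> 0 \<and> norm x = norm y \<and> q x / q y > l))"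
      by blast
  qed
qed

end
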